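(* On $2^{\mathbb N\times\mathbb N}$, Doob randomness is incomparable with Schnorr randomness: there is $\omega$ that is Doob random but not Schnorr random, and there is $\omega$ that is Schnorr random but not Doob random.
   Context: $2^{\mathbb N\times\mathbb N}$ carries the uniform (fair-coin product) measure and is identified with $(2^{\mathbb N})^{\mathbb N}$ via rows $\omega_m=(\omega_{m,0},\omega_{m,1},\dots)$. For $\omega\in(2^{\mathbb N})^{\mathbb N}$: $\omega_{<n}=(\omega_0,\dots,\omega_{n-1})$, $\omega_{<n}{}^\frown\xi=(\omega_0,\dots,\omega_{n-1},\xi_0,\xi_1,\dots)$, $\mathbb E_n(g)(\omega)=\int g(\omega_{<n}{}^\frown\xi)\,d\mathbb P(\xi)$. A martingale is $(M_n)$ with $M_n(\omega)$ a.s. depending only on $n,\omega_{<n}$ and $\mathbb E_mM_n=M_m$ for $m\le n$; computable if $M_n(\omega)$ is uniformly computable from $n$ and $\omega_{<n}$. $\omega$ is Doob random if $(M_n(\omega))$ converges to a real number for every nonnegative computable martingale. $\omega$ is Schnorr random if $\bigoplus_n\omega_n\in2^{\mathbb N}$ lies in no $\bigcap_kU_k$ for a computable sequence of effectively open $U_k$ with measures $\le2^{-k}$ computable uniformly in $k$. *)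

theory Defs
  imports "HOL-Probability.Probability" "HOL-Library.Nat_Bijection" "HOL-Library.Countable"
begin

section \<open>Computability relative to an oracle\<close>

text \<open>
  Programs for the partial recursive functionals.  Programs take a single number; several
  arguments are passed through Cantor pairing \<^const>\<open>prod_encode\<close>.
\<close>

datatype recfun =
    Zero
  | Succ
  | Fst
  | Snd
  | Query
  | Tuple recfun recfun
  | Compose recfun recfun
  | PrimRec recfun recfun
  | Mu recfun

text \<open>\<open>computes A p x y\<close>: with oracle \<open>A\<close>, program \<open>p\<close> halts on input \<open>x\<close> with output \<open>y\<close>.\<close>

inductive computes :: "(nat \<Rightarrow> nat) \<Rightarrow> recfun \<Rightarrow> nat \<Rightarrow> nat \<Rightarrow> bool" for A where
  zero: "computes A Zero x 0"
| succ: "computes A Succ x (Suc x)"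
| fst: "computes A Fst x (fst (prod_decode x))"
| snd: "computes A Snd x (snd (prod_decode x))"
| query: "computes A Query x (A x)"
| tuple: "computes A p x y \<Longrightarrow> computes A q x z \<Longrightarrow> computes A (Tuple p q) x (prod_encode (y, z))"
| compose: "computes A q x y \<Longrightarrow> computes A p y z \<Longrightarrow> computes A (Compose p q) x z"
| primrec_0: "computes A p x y \<Longrightarrow> computes A (PrimRec p q) (prod_encode (x, 0)) y"
| primrec_Suc: "computes A (PrimRec p q) (prod_encode (x, n)) y \<Longrightarrow>
    computes A q (prod_encode (x, prod_encode (n, y))) z \<Longrightarrow>
    computes A (PrimRec p q) (prod_encode (x, Suc n)) z"
| mu: "computes A p (prod_encode (x, n)) 0 \<Longrightarrow>
    (\<And>m. m < n \<Longrightarrow> \<exists>v. computes A p (prod_encode (x, m)) (Suc v)) \<Longrightarrow>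
    computes A (Mu p) x n"

lemma computes_deterministic:
  "computes A p x y \<Longrightarrow> computes A p x z \<Longrightarrow> y = z"
proof (induction arbitrary: z rule: computes.induct)
  case (tuple p x y q z z')
  from tuple.prems show ?case
    by cases (use tuple.IH in auto)
next
  case (compose q x y p z z')
  from compose.prems show ?case
    by cases (use compose.IH in blast)
next
  case (primrec_0 p x y q)
  from primrec_0.prems show ?case
    by cases (use primrec_0.IH in auto)
next
  case (primrec_Suc p q x n y z z')
  from primrec_Suc.prems show ?case
    by cases (use primrec_Suc.IH in auto)
next
  case (mu p x n)
  from mu.prems show ?case
  proof cases
    case mu
    show ?thesis
    proof (rule linorder_cases[of n z])
      assume "n < z"
      with mu(2) obtain v where "computes A p (prod_encode (x, n)) (Suc v)"
        by blast
      with mu.IH(1) show ?thesis by force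
    next
      assume "z < n"
      with mu.IH(2) mu(1) show ?thesis by force
    qed
  qed
qed (auto elim: computes.cases)

text \<open>Absolute computability is computability with the constantly-zero oracle.\<close>

abbreviation no_oracle :: "nat \<Rightarrow> nat" where
  "no_oracle \<equiv> \<lambda>_. 0"

text \<open>
  \<open>names_real A p x r\<close>: on input \<open>(x, k)\<close>, program \<open>p\<close> with oracle \<open>A\<close> outputs the index,
  in the effective enumeration \<^const>\<open>nat_to_rat_surj\<close> of the rationals, of a rational at
  distance at most $2^{-k}$ from \<open>r\<close>.
\<close>

definition names_real :: "(nat \<Rightarrow> nat) \<Rightarrow> recfun \<Rightarrow> nat \<Rightarrow> real \<Rightarrow> bool" where
  "names_real A p x r \<longleftrightarrow>
     (\<forall>k. \<exists>q. computes A p (prod_encode (x, k)) q \<and>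
          \<bar>real_of_rat (nat_to_rat_surj q) - r\<bar> \<le> (1 / 2) ^ k)"

definition computable_real_seq :: "(nat \<Rightarrow> real) \<Rightarrow> bool" where
  "computable_real_seq r \<longleftrightarrow> (\<exists>p. \<forall>n. names_real no_oracle p n (r n))"

section \<open>Cantor space and the space of sequences of rows\<close>

definition cantor :: "(nat \<Rightarrow> bool) measure" where
  "cantor = (\<Pi>\<^sub>M i\<in>UNIV. measure_pmf (bernoulli_pmf (1 / 2)))"

text \<open>
  $2^{\mathbb{N}\times\mathbb{N}}$ is represented by its rows: \<open>\<omega> m j\<close> is the entry at \<open>(m, j)\<close>.
\<close>

definition rows :: "(nat \<Rightarrow> nat \<Rightarrow> bool) measure" where
  "rows = (\<Pi>\<^sub>M m\<in>UNIV. cantor)"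

definition join_rows :: "(nat \<Rightarrow> nat \<Rightarrow> bool) \<Rightarrow> nat \<Rightarrow> bool" where
  "join_rows \<omega> k = (case prod_decode k of (m, j) \<Rightarrow> \<omega> m j)"

definition initial_rows :: "nat \<Rightarrow> (nat \<Rightarrow> nat \<Rightarrow> bool) \<Rightarrow> (nat \<Rightarrow> bool) list" where
  "initial_rows n \<omega> = map \<omega> [0..<n]"

text \<open>
  The oracle presenting a tuple of rows; queries about rows outside the tuple are answered
  by \<open>0\<close>, so that they carry no information.
\<close>

definition rows_oracle :: "(nat \<Rightarrow> bool) list \<Rightarrow> nat \<Rightarrow> nat" where
  "rows_oracle rs k = (case prod_decode k of (m, j) \<Rightarrow>
     if m < length rs then of_bool ((rs ! m) j) else 0)"

section \<open>Doob randomness\<close>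

text \<open>\<^const>\<open>comb_seq\<close>\<open> n \<omega> \<xi>\<close> consists of the first \<open>n\<close> rows of \<open>\<omega>\<close> followed by all rows of \<open>\<xi>\<close>.\<close>

definition cond_expect ::
  "nat \<Rightarrow> ((nat \<Rightarrow> nat \<Rightarrow> bool) \<Rightarrow> real) \<Rightarrow> (nat \<Rightarrow> nat \<Rightarrow> bool) \<Rightarrow> real" where
  "cond_expect n g \<omega> = (\<integral>\<xi>. g (comb_seq n \<omega> \<xi>) \<partial>rows)"

definition martingale :: "(nat \<Rightarrow> (nat \<Rightarrow> nat \<Rightarrow> bool) \<Rightarrow> real) \<Rightarrow> bool" where
  "martingale M \<longleftrightarrow>
     (\<forall>n. integrable rows (M n)) \<and>
     (\<forall>n. \<exists>g. AE \<omega> in rows. M n \<omega> = g (initial_rows n \<omega>)) \<and>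
     (\<forall>n. \<forall>m\<le>n. AE \<omega> in rows. cond_expect m (M n) \<omega> = M m \<omega>)"

definition computable_martingale :: "(nat \<Rightarrow> (nat \<Rightarrow> nat \<Rightarrow> bool) \<Rightarrow> real) \<Rightarrow> bool" where
  "computable_martingale M \<longleftrightarrow> martingale M \<and>
     (\<exists>p. \<forall>n \<omega>. names_real (rows_oracle (initial_rows n \<omega>)) p n (M n \<omega>))"

definition Doob_random :: "(nat \<Rightarrow> nat \<Rightarrow> bool) \<Rightarrow> bool" where
  "Doob_random \<omega> \<longleftrightarrow>
     (\<forall>M. computable_martingale M \<and> (\<forall>n \<omega>'. 0 \<le> M n \<omega>') \<longrightarrow> convergent (\<lambda>n. M n \<omega>))"

section \<open>Schnorr randomness\<close>

definition cylinder :: "bool list \<Rightarrow> (nat \<Rightarrow> bool) set" where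
  "cylinder \<sigma> = {x. \<forall>i<length \<sigma>. x i = \<sigma> ! i}"

text \<open>
  The sets \<open>U k\<close> are uniformly effectively open: they are generated by a computably enumerable
  (i.e. domain of a partial computable function) set of pairs \<open>(k, \<sigma>)\<close>.
\<close>

definition effectively_open_seq :: "(nat \<Rightarrow> (nat \<Rightarrow> bool) set) \<Rightarrow> bool" where
  "effectively_open_seq U \<longleftrightarrow>
     (\<exists>p. \<forall>k. U k = (\<Union>\<sigma> \<in> {\<sigma>. \<exists>y. computes no_oracle p
        (prod_encode (k, list_encode (map of_bool \<sigma>))) y}. cylinder \<sigma>))"

definition Schnorr_test :: "(nat \<Rightarrow> (nat \<Rightarrow> bool) set) \<Rightarrow> bool" where
  "Schnorr_test U \<longleftrightarrow> effectively_open_seq U \<and>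
     (\<forall>k. measure cantor (U k) \<le> (1 / 2) ^ k) \<and>
     computable_real_seq (\<lambda>k. measure cantor (U k))"

definition Schnorr_random :: "(nat \<Rightarrow> nat \<Rightarrow> bool) \<Rightarrow> bool" where
  "Schnorr_random \<omega> \<longleftrightarrow> (\<forall>U. Schnorr_test U \<longrightarrow> join_rows \<omega> \<notin> (\<Inter>k. U k))"

end

theory Submission
  imports Defs
begin

text \<open>
  Doob random but not Schnorr random.  A computable martingale is continuous in the next row, so it
  cannot distinguish an open dense set of small measure from the whole space.  Hence all rows can be
  chosen in such sets, which is a Schnorr null event, while a weighted sum of the capitals of
  upcrossing strategies against all computable martingales stays bounded.

  Schnorr random but not Doob random.  A martingale reads a program off the row of its last bet and
  bets again on the first row whose index certifies that this program has halted.  A Schnorr test has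
  a computable modulus beyond which it carries almost no measure.  If the programs coded in the
  sequence compute functions dominating the moduli of more and more tests, the winning bets and the
  codes lie where those tests no longer see them, so they can be forced without entering the tests.
\<close>

section \<open>Computable functionals and a decidable notion of halting certificate\<close>

section \<open>Closure properties of computable functionals\<close>

text \<open>A row carries infinitely many bits but is revealed to a martingale in one step; both
  halves rest on this. In the first half the obstacle is that fairness holds only almost everywhere,
  while the sequence sought lies in a null set. Each open dense set contains finite conditions of
  positive measure, so a row can be chosen inside it and still keep almost all continuations fair.
  In the second half no computable list of all tests with their moduli is available, so the sequence
  itself must supply the programs. Certificates serve two purposes: being one is decidable, so the
  martingale is total, and a certificate is a number larger than the output it certifies, so the
  index of the next betting row automatically bounds the moduli.\<close>

abbreviation pi1 :: "nat \<Rightarrow> nat" where "pi1 z \<equiv> fst (prod_decode z)"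
abbreviation pi2 :: "nat \<Rightarrow> nat" where "pi2 z \<equiv> snd (prod_decode z)"

text \<open>One program has to serve every oracle of the class: the moduli of tests use the class
  \<open>{no_oracle}\<close>, the betting martingale the class of all oracles.\<close>

definition computable_over :: "(nat \<Rightarrow> nat) set \<Rightarrow> ((nat \<Rightarrow> nat) \<Rightarrow> nat \<Rightarrow> nat) \<Rightarrow> bool" where
  "computable_over \<O> f \<longleftrightarrow> (\<exists>p. \<forall>A\<in>\<O>. \<forall>x. computes A p x (f A x))"

abbreviation decidable_over :: "(nat \<Rightarrow> nat) set \<Rightarrow> ((nat \<Rightarrow> nat) \<Rightarrow> nat \<Rightarrow> bool) \<Rightarrow> bool" where
  "decidable_over \<O> P \<equiv> computable_over \<O> (\<lambda>A x. of_bool (P A x))"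

lemma computable_overI: "(\<And>A x. A \<in> \<O> \<Longrightarrow> computes A p x (f A x)) \<Longrightarrow> computable_over \<O> f"
  unfolding computable_over_def by blast

lemma computable_overE:
  assumes "computable_over \<O> f"
  obtains p where "\<And>A x. A \<in> \<O> \<Longrightarrow> computes A p x (f A x)"
  using assms unfolding computable_over_def by blast

lemma computable_id: "computable_over \<O> (\<lambda>A x. x)"
proof (rule computable_overI)
  fix A and x :: nat
  show "computes A (Tuple Fst Snd) x x"
    using computes.tuple[OF computes.fst computes.snd, of A x] by simp
qed

lemma computable_compose:
  assumes "computable_over \<O> f" "computable_over \<O> g"
  shows "computable_over \<O> (\<lambda>A x. f A (g A x))"
proof -
  from assms(1) obtain p where p: "\<And>A x. A \<in> \<O> \<Longrightarrow> computes A p x (f A x)"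
    by (elim computable_overE) (rule that)
  from assms(2) obtain q where q: "\<And>A x. A \<in> \<O> \<Longrightarrow> computes A q x (g A x)"
    by (elim computable_overE) (rule that)
  show ?thesis
    by (rule computable_overI[of _ "Compose p q"]) (blast intro: computes.compose p q)
qed

lemma computable_fst: "computable_over \<O> f \<Longrightarrow> computable_over \<O> (\<lambda>A x. pi1 (f A x))"
  by (rule computable_compose[of _ "\<lambda>A x. pi1 x"]) (blast intro: computable_overI computes.fst)

lemma computable_snd: "computable_over \<O> f \<Longrightarrow> computable_over \<O> (\<lambda>A x. pi2 (f A x))"
  by (rule computable_compose[of _ "\<lambda>A x. pi2 x"]) (blast intro: computable_overI computes.snd)

lemma computable_Suc: "computable_over \<O> f \<Longrightarrow> computable_over \<O> (\<lambda>A x. Suc (f A x))"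
  by (rule computable_compose[of _ "\<lambda>A x. Suc x"]) (blast intro: computable_overI computes.succ)

lemma computable_query: "computable_over \<O> f \<Longrightarrow> computable_over \<O> (\<lambda>A x. A (f A x))"
  by (rule computable_compose[of _ "\<lambda>A x. A x"]) (blast intro: computable_overI computes.query)

lemma computable_const: "computable_over \<O> (\<lambda>A x. c)"
proof (induction c)
  case 0
  show ?case by (blast intro: computable_overI computes.zero)
qed (rule computable_Suc)

lemma computable_pair:
  assumes "computable_over \<O> f" "computable_over \<O> g"
  shows "computable_over \<O> (\<lambda>A x. prod_encode (f A x, g A x))"
proof -
  from assms(1) obtain p where p: "\<And>A x. A \<in> \<O> \<Longrightarrow> computes A p x (f A x)"
    by (elim computable_overE) (rule that)
  from assms(2) obtain q where q: "\<And>A x. A \<in> \<O> \<Longrightarrow> computes A q x (g A x)"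
    by (elim computable_overE) (rule that)
  show ?thesis
    by (rule computable_overI[of _ "Tuple p q"]) (blast intro: computes.tuple p q)
qed

text \<open>\<open>PrimRec\<close> recurses on the second component of its input, so the recursion
  is built on pairs of a parameter and a bound and then composed with \<open>n\<close>.\<close>

lemma computable_rec:
  assumes b: "computable_over \<O> b"
    and s: "computable_over \<O> (\<lambda>A z. s A (pi1 z) (pi1 (pi2 z)) (pi2 (pi2 z)))"
    and n: "computable_over \<O> n"
  shows "computable_over \<O> (\<lambda>A x. rec_nat (b A x) (s A x) (n A x))"
proof -
  from b obtain p where p: "\<And>A x. A \<in> \<O> \<Longrightarrow> computes A p x (b A x)"
    by (elim computable_overE) (rule that)
  from s obtain q where
    q: "\<And>A z. A \<in> \<O> \<Longrightarrow> computes A q z (s A (pi1 z) (pi1 (pi2 z)) (pi2 (pi2 z)))"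
    by (elim computable_overE) (rule that)
  have rec: "computes A (PrimRec p q) (prod_encode (x, k)) (rec_nat (b A x) (s A x) k)"
    if "A \<in> \<O>" for A x k
  proof (induction k)
    case 0
    show ?case using p[OF that] by (simp add: computes.primrec_0)
  next
    case (Suc k)
    show ?case
      using computes.primrec_Suc[OF Suc] q[OF that, of "prod_encode (x, prod_encode (k, _))"]
      by simp
  qed
  have "computable_over \<O> (\<lambda>A z. rec_nat (b A (pi1 z)) (s A (pi1 z)) (pi2 z))"
  proof (rule computable_overI)
    fix A z assume "A \<in> \<O>"
    from rec[OF this, of "pi1 z" "pi2 z"]
    show "computes A (PrimRec p q) z (rec_nat (b A (pi1 z)) (s A (pi1 z)) (pi2 z))"
      by simp
  qed
  from computable_compose[OF this computable_pair[OF computable_id n]]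
  show ?thesis by simp
qed

lemma computable_add:
  assumes "computable_over \<O> f" "computable_over \<O> g"
  shows "computable_over \<O> (\<lambda>A x. f A x + g A x)"
proof -
  have *: "a + b = rec_nat a (\<lambda>_ acc. Suc acc) b" for a b :: nat
    by (induction b) auto
  show ?thesis
    unfolding * by (intro computable_rec assms computable_Suc computable_snd computable_id)
qed

lemma computable_pred:
  assumes "computable_over \<O> f"
  shows "computable_over \<O> (\<lambda>A x. f A x - 1)"
proof -
  have *: "a - 1 = rec_nat 0 (\<lambda>i _. i) a" for a :: nat
    by (cases a) auto
  show ?thesis
    unfolding * by (intro computable_rec assms computable_const computable_fst computable_snd computable_id)
qed

lemma computable_diff:
  assumes "computable_over \<O> f" "computable_over \<O> g"
  shows "computable_over \<O> (\<lambda>A x. f A x - g A x)"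
proof -
  have "a - b = rec_nat a (\<lambda>_ acc. acc - 1) b" for a b :: nat
    by (induction b) auto
  \<comment> \<open>The right-hand side subtracts again, so it is used as an equation between whole
    functions and not as a rewrite rule.\<close>
  then have "(\<lambda>A x. f A x - g A x) = (\<lambda>A x. rec_nat (f A x) (\<lambda>_ acc. acc - 1) (g A x))"
    by blast
  then show ?thesis
    by (simp only:)  (intro computable_rec assms computable_pred computable_snd computable_id)
qed

lemma computable_mult:
  assumes "computable_over \<O> f" "computable_over \<O> g"
  shows "computable_over \<O> (\<lambda>A x. f A x * g A x)"
proof -
  have *: "a * b = rec_nat 0 (\<lambda>_ acc. a + acc) b" for a b :: nat
    by (induction b) auto
  show ?thesis
    unfolding *
    by (intro computable_rec assms computable_add computable_snd computable_id computable_const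
        computable_compose[OF assms(1)] computable_fst)
qed

lemma computable_power:
  assumes "computable_over \<O> f" "computable_over \<O> g"
  shows "computable_over \<O> (\<lambda>A x. f A x ^ g A x)"
proof -
  have *: "a ^ b = rec_nat 1 (\<lambda>_ acc. a * acc) b" for a b :: nat
    by (induction b) auto
  show ?thesis
    unfolding *
    by (intro computable_rec assms computable_mult computable_snd computable_id computable_const
        computable_compose[OF assms(1)] computable_fst)
qed

lemma computable_sum:
  assumes n: "computable_over \<O> n"
    and f: "computable_over \<O> (\<lambda>A z. f A (pi1 z) (pi2 z))"
  shows "computable_over \<O> (\<lambda>A x. \<Sum>i<n A x. f A x i)"
proof -
  have *: "(\<Sum>i<k. h i) = rec_nat 0 (\<lambda>i acc. h i + acc) k" for h :: "nat \<Rightarrow> nat" and k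
    by (induction k) auto
  have f': "computable_over \<O> (\<lambda>A z. f A (pi1 z) (pi1 (pi2 z)))"
    using computable_compose[OF f, of "\<lambda>A z. prod_encode (pi1 z, pi1 (pi2 z))"]
    by (simp add: computable_pair computable_fst computable_snd computable_id)
  show ?thesis
    unfolding *
    by (intro computable_rec n computable_add f' computable_snd computable_id computable_const)
qed

lemma decidable_not:
  assumes "decidable_over \<O> P"
  shows "decidable_over \<O> (\<lambda>A x. \<not> P A x)"
proof -
  have *: "of_bool (\<not> b) = (1::nat) - of_bool b" for b
    by simp
  show ?thesis unfolding * by (intro computable_diff computable_const assms)
qed

lemma decidable_conj:
  "decidable_over \<O> P \<Longrightarrow> decidable_over \<O> Q \<Longrightarrow> decidable_over \<O> (\<lambda>A x. P A x \<and> Q A x)"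
  using computable_mult[of \<O> "\<lambda>A x. of_bool (P A x)" "\<lambda>A x. of_bool (Q A x)"]
  by (simp add: of_bool_conj)

lemma decidable_disj:
  assumes "decidable_over \<O> P" "decidable_over \<O> Q"
  shows "decidable_over \<O> (\<lambda>A x. P A x \<or> Q A x)"
proof -
  have *: "a \<or> b \<longleftrightarrow> \<not> (\<not> a \<and> \<not> b)" for a b
    by blast
  show ?thesis unfolding * by (intro decidable_not decidable_conj assms)
qed

lemma decidable_imp:
  "decidable_over \<O> P \<Longrightarrow> decidable_over \<O> Q \<Longrightarrow> decidable_over \<O> (\<lambda>A x. P A x \<longrightarrow> Q A x)"
  unfolding imp_conv_disj by (intro decidable_not decidable_disj)

lemma decidable_le:
  assumes "computable_over \<O> f" "computable_over \<O> g"
  shows "decidable_over \<O> (\<lambda>A x. f A x \<le> g A x)"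
proof -
  have *: "of_bool (a \<le> b) = (1::nat) - (a - b)" for a b :: nat
    by auto
  show ?thesis unfolding * by (intro computable_diff computable_const assms)
qed

lemma decidable_less:
  "computable_over \<O> f \<Longrightarrow> computable_over \<O> g \<Longrightarrow> decidable_over \<O> (\<lambda>A x. f A x < g A x)"
  unfolding Suc_le_eq[symmetric] by (intro decidable_le computable_Suc)

lemma decidable_eq:
  "computable_over \<O> f \<Longrightarrow> computable_over \<O> g \<Longrightarrow> decidable_over \<O> (\<lambda>A x. f A x = g A x)"
  unfolding eq_iff by (intro decidable_conj decidable_le)

lemma computable_if:
  assumes "decidable_over \<O> P" "computable_over \<O> f" "computable_over \<O> g"
  shows "computable_over \<O> (\<lambda>A x. if P A x then f A x else g A x)"
proof -
  have *: "(if Q then a else b) = of_bool Q * a + of_bool (\<not> Q) * b" for Q and a b :: nat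
    by simp
  show ?thesis
    unfolding * by (intro computable_add computable_mult decidable_not assms)
qed

lemma decidable_ex_less:
  assumes "computable_over \<O> n" "decidable_over \<O> (\<lambda>A z. P A (pi1 z) (pi2 z))"
  shows "decidable_over \<O> (\<lambda>A x. \<exists>i<n A x. P A x i)"
proof -
  have *: "(\<exists>i<k. Q i) \<longleftrightarrow> 0 < (\<Sum>i<k. of_bool (Q i) :: nat)" for k :: nat and Q
    by (metis (no_types, lifting) bot_nat_0.not_eq_extremum finite_lessThan lessThan_iff of_bool_eq_0_iff
        sum_eq_0_iff)
  show ?thesis
    unfolding * by (intro decidable_less computable_const computable_sum assms)
qed

lemma decidable_all_less:
  assumes "computable_over \<O> n" "decidable_over \<O> (\<lambda>A z. P A (pi1 z) (pi2 z))"
  shows "decidable_over \<O> (\<lambda>A x. \<forall>i<n A x. P A x i)"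
  using decidable_not[OF decidable_ex_less[OF assms(1) decidable_not[OF assms(2)]]] by simp

lemma computable_div:
  assumes "computable_over \<O> f" "computable_over \<O> g"
  shows "computable_over \<O> (\<lambda>A x. f A x div g A x)"
proof -
  \<comment> \<open>The quotient counts the positive multiples of \<open>b\<close> up to
    \<open>a\<close>; the conjunct \<open>0 < b\<close> gives division by zero its value 0.\<close>
  have *: "a div b = (\<Sum>i<a. of_bool (0 < b \<and> Suc i * b \<le> a))" for a b :: nat
  proof (cases "b = 0")
    case False
    then have "{i. i < a \<and> Suc i * b \<le> a} = {..<a div b}"
      by (auto simp: Suc_le_eq[symmetric] less_eq_div_iff_mult_less_eq simp del: mult_Suc)
        (metis Suc_le_eq div_le_dividend le_trans less_eq_div_iff_mult_less_eq)
    moreover have "(\<Sum>i<a. of_bool (Suc i * b \<le> a)) = card {i. i < a \<and> Suc i * b \<le> a}"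
      by (simp add: sum.If_cases of_bool_def Int_def del: mult_Suc)
    ultimately show ?thesis using False by simp
  qed simp
  show ?thesis
    unfolding *
    by (intro computable_sum assms decidable_conj decidable_less decidable_le computable_const
        computable_mult computable_Suc computable_fst computable_snd computable_id
        computable_compose[OF assms(1)] computable_compose[OF assms(2)])
qed

lemma computable_mod:
  "computable_over \<O> f \<Longrightarrow> computable_over \<O> g \<Longrightarrow> computable_over \<O> (\<lambda>A x. f A x mod g A x)"
  unfolding modulo_nat_def by (intro computable_diff computable_mult computable_div)

lemma computable_Least:
  assumes P: "decidable_over \<O> (\<lambda>A z. P A (pi1 z) (pi2 z))"
    and ex: "\<And>A x. A \<in> \<O> \<Longrightarrow> \<exists>n. P A x n"
  shows "computable_over \<O> (\<lambda>A x. LEAST n. P A x n)"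
proof -
  from decidable_not[OF P] obtain p where
    p: "\<And>A z. A \<in> \<O> \<Longrightarrow> computes A p z (of_bool (\<not> P A (pi1 z) (pi2 z)))"
    by (elim computable_overE) (rule that)
  show ?thesis
  proof (rule computable_overI)
    fix A x assume A: "A \<in> \<O>"
    show "computes A (Mu p) x (LEAST n. P A x n)"
    proof (rule computes.mu)
      show "computes A p (prod_encode (x, LEAST n. P A x n)) 0"
        using p[OF A, of "prod_encode (x, LEAST n. P A x n)"] LeastI_ex[OF ex[OF A]] by simp
      fix m assume "m < (LEAST n. P A x n)"
      then show "\<exists>v. computes A p (prod_encode (x, m)) (Suc v)"
        using p[OF A, of "prod_encode (x, m)"] not_less_Least by fastforce
    qed
  qed
qed

lemma semidecidable_ex:
  assumes P: "decidable_over \<O> (\<lambda>A z. P A (pi1 z) (pi2 z))"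
  shows "\<exists>p. \<forall>A\<in>\<O>. \<forall>x. (\<exists>y. computes A p x y) \<longleftrightarrow> (\<exists>n. P A x n)"
proof -
  from decidable_not[OF P] obtain p where
    p: "\<And>A z. A \<in> \<O> \<Longrightarrow> computes A p z (of_bool (\<not> P A (pi1 z) (pi2 z)))"
    by (elim computable_overE) (rule that)
  have "(\<exists>y. computes A (Mu p) x y) \<longleftrightarrow> (\<exists>n. P A x n)" if A: "A \<in> \<O>" for A x
  proof
    assume "\<exists>y. computes A (Mu p) x y"
    then obtain y where "computes A p (prod_encode (x, y)) 0"
      by (auto elim: computes.cases)
    with p[OF A, of "prod_encode (x, y)"] show "\<exists>n. P A x n"
      by (auto dest: computes_deterministic)
  next
    assume ex: "\<exists>n. P A x n"
    have "computes A (Mu p) x (LEAST n. P A x n)"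
    proof (rule computes.mu)
      show "computes A p (prod_encode (x, LEAST n. P A x n)) 0"
        using p[OF A, of "prod_encode (x, LEAST n. P A x n)"] LeastI_ex[OF ex] by simp
      fix m assume "m < (LEAST n. P A x n)"
      then show "\<exists>v. computes A p (prod_encode (x, m)) (Suc v)"
        using p[OF A, of "prod_encode (x, m)"] not_less_Least by fastforce
    qed
    then show "\<exists>y. computes A (Mu p) x y" by blast
  qed
  then show ?thesis by blast
qed

lemmas computable_intros =
  computable_const computable_id computable_fst computable_snd computable_Suc computable_query computable_pair
  computable_add computable_diff computable_mult computable_power computable_sum computable_div
  computable_mod computable_if decidable_not decidable_conj decidable_disj decidable_imp
  decidable_le decidable_less decidable_eq decidable_ex_less decidable_all_less


section \<open>Coded lists\<close>

text \<open>A nonempty list has code \<open>Suc (prod_encode (x, c))\<close> with \<open>c\<close>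
  the code of its tail. The code 0 of the empty list is a fixed point of the step because
  \<open>prod_decode 0\<close> is \<open>(0, 0)\<close>.\<close>

definition drop_code :: "nat \<Rightarrow> nat \<Rightarrow> nat" where
  "drop_code c i = rec_nat c (\<lambda>_ acc. pi2 (acc - 1)) i"

definition nth_code :: "nat \<Rightarrow> nat \<Rightarrow> nat" where
  "nth_code c i = pi1 (drop_code c i - 1)"

lemma prod_decode_0 [simp]: "prod_decode 0 = (0, 0)"
  by (metis le_0_eq le_prod_encode_1 le_prod_encode_2 prod_decode_inverse surj_pair)

lemma drop_code_list_encode: "drop_code (list_encode xs) i = list_encode (drop i xs)"
proof (induction i)
  case (Suc i)
  have *: "pi2 (list_encode ys - Suc 0) = list_encode (tl ys)" for ys
    by (cases ys) auto
  from Suc show ?case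
    by (simp add: drop_code_def * drop_Suc tl_drop)
qed (simp add: drop_code_def)

lemma drop_code: "drop_code c i = list_encode (drop i (list_decode c))"
  by (metis drop_code_list_encode list_decode_inverse)

lemma nth_code_list_encode:
  "nth_code (list_encode xs) i = (if i < length xs then xs ! i else 0)"
proof (cases "drop i xs")
  case (Cons y ys)
  then have "i < length xs" by (metis drop_all list.distinct(1) not_le)
  with Cons show ?thesis
    by (simp add: nth_code_def drop_code_list_encode) (metis nth_via_drop)
qed (simp add: nth_code_def drop_code_list_encode)

lemma length_le_list_encode: "length xs \<le> list_encode xs"
  by (induction xs) (auto intro: le_trans le_prod_encode_2)

lemma elem_less_list_encode: "x \<in> set xs \<Longrightarrow> x < list_encode xs"
proof (induction xs)
  case (Cons y ys)
  then show ?case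
    using le_prod_encode_1[of y "list_encode ys"] le_prod_encode_2[of "list_encode ys" y]
    by auto
qed simp

text \<open>The code of a list bounds its length and thus the search for a position;
  \<open>drop_code c i \<noteq> 0\<close> excludes the default value 0 of \<open>nth_code\<close>
  past the end.\<close>

lemma mem_list_decode_iff:
  "x \<in> set (list_decode c) \<longleftrightarrow> (\<exists>i<c. drop_code c i \<noteq> 0 \<and> nth_code c i = x)"
proof -
  obtain xs where c: "c = list_encode xs"
    by (metis list_decode_inverse)
  have "i < list_encode xs" if "i < length xs" for i
    using that length_le_list_encode[of xs] by linarith
  moreover have "list_encode (drop i xs) \<noteq> 0 \<longleftrightarrow> i < length xs" for i
    by (metis drop_eq_Nil list_encode.simps(1) list_encode_eq not_le)
  ultimately show ?thesis
    unfolding c by (auto simp: in_set_conv_nth nth_code_list_encode drop_code_list_encode)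
qed

lemma computable_drop_code:
  "computable_over \<O> f \<Longrightarrow> computable_over \<O> g \<Longrightarrow> computable_over \<O> (\<lambda>A x. drop_code (f A x) (g A x))"
  unfolding drop_code_def by (intro computable_rec computable_intros)

lemma computable_nth_code:
  "computable_over \<O> f \<Longrightarrow> computable_over \<O> g \<Longrightarrow> computable_over \<O> (\<lambda>A x. nth_code (f A x) (g A x))"
  unfolding nth_code_def by (intro computable_intros computable_drop_code)

lemma decidable_mem_list_decode:
  assumes "computable_over \<O> f" "computable_over \<O> g"
  shows "decidable_over \<O> (\<lambda>A x. f A x \<in> set (list_decode (g A x)))"
  unfolding mem_list_decode_iff
  by (intro computable_intros computable_drop_code computable_nth_code assms
      computable_compose[OF assms(1)] computable_compose[OF assms(2)])

section \<open>A universal halting certificate\<close>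

text \<open>\<open>Zero\<close> receives the code 0, which is later the program read off an empty
  run of ones.\<close>

fun encode_recfun :: "recfun \<Rightarrow> nat" where
  "encode_recfun Zero = prod_encode (0, 0)"
| "encode_recfun Succ = prod_encode (1, 0)"
| "encode_recfun Fst = prod_encode (2, 0)"
| "encode_recfun Snd = prod_encode (3, 0)"
| "encode_recfun Query = prod_encode (4, 0)"
| "encode_recfun (Tuple p q) = prod_encode (5, prod_encode (encode_recfun p, encode_recfun q))"
| "encode_recfun (Compose p q) = prod_encode (6, prod_encode (encode_recfun p, encode_recfun q))"
| "encode_recfun (PrimRec p q) = prod_encode (7, prod_encode (encode_recfun p, encode_recfun q))"
| "encode_recfun (Mu p) = prod_encode (8, encode_recfun p)"

abbreviation judgement :: "nat \<Rightarrow> nat \<Rightarrow> nat \<Rightarrow> nat" where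
  "judgement e x y \<equiv> prod_encode (e, prod_encode (x, y))"

text \<open>
  The judgement \<open>judgement e x y\<close> (program \<open>e\<close> without oracle maps \<open>x\<close> to \<open>y\<close>) follows by one
  rule of \<^const>\<open>computes\<close> from the judgements in \<open>S\<close>.  The numbers 0 to 8 are the tags used by
  \<^const>\<open>encode_recfun\<close>.
\<close>

definition justified :: "nat set \<Rightarrow> nat \<Rightarrow> nat \<Rightarrow> nat \<Rightarrow> bool" where
  "justified S e x y \<longleftrightarrow>
     pi1 e = 0 \<and> y = 0 \<or>
     pi1 e = 1 \<and> y = Suc x \<or>
     pi1 e = 2 \<and> y = pi1 x \<or>
     pi1 e = 3 \<and> y = pi2 x \<or>
     pi1 e = 4 \<and> y = 0 \<or>
     pi1 e = 5 \<and> judgement (pi1 (pi2 e)) x (pi1 y) \<in> S \<and> judgement (pi2 (pi2 e)) x (pi2 y) \<in> S \<or>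
     pi1 e = 6 \<and> (\<exists>z. judgement (pi2 (pi2 e)) x z \<in> S \<and> judgement (pi1 (pi2 e)) z y \<in> S) \<or>
     pi1 e = 7 \<and> pi2 x = 0 \<and> judgement (pi1 (pi2 e)) (pi1 x) y \<in> S \<or>
     pi1 e = 7 \<and> pi2 x \<noteq> 0 \<and>
       (\<exists>z. judgement e (prod_encode (pi1 x, pi2 x - 1)) z \<in> S \<and>
          judgement (pi2 (pi2 e)) (prod_encode (pi1 x, prod_encode (pi2 x - 1, z))) y \<in> S) \<or>
     pi1 e = 8 \<and> judgement (pi2 e) (prod_encode (x, y)) 0 \<in> S \<and>
       (\<forall>m<y. \<exists>v. judgement (pi2 e) (prod_encode (x, m)) (Suc v) \<in> S)"

primrec valid_derivation :: "nat list \<Rightarrow> bool" where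
  "valid_derivation [] \<longleftrightarrow> True"
| "valid_derivation (t # ts) \<longleftrightarrow>
     justified (set ts) (pi1 t) (pi1 (pi2 t)) (pi2 (pi2 t)) \<and> valid_derivation ts"

definition halting_certificate :: "nat \<Rightarrow> nat \<Rightarrow> nat \<Rightarrow> bool" where
  "halting_certificate e x c \<longleftrightarrow>
     valid_derivation (list_decode c) \<and> (\<exists>y. judgement e x y \<in> set (list_decode c))"

lemma justified_mono: "justified S e x y \<Longrightarrow> S \<subseteq> S' \<Longrightarrow> justified S' e x y"
  unfolding justified_def by (elim disjE) (auto dest: subsetD, blast+)

text \<open>Not every number codes a program, and derivations may contain judgements about such
  numbers. They are harmless: a judgement about a coded program rests only on judgements about that
  program and its subprograms, which are coded as well.\<close>

lemma justified_sound:
  assumes S: "\<And>p x y. judgement (encode_recfun p) x y \<in> S \<Longrightarrow> computes no_oracle p x y"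
    and just: "justified S (encode_recfun p) x y"
  shows "computes no_oracle p x y"
proof (cases p)
  case Zero
  then show ?thesis using just by (simp add: justified_def computes.zero)
next
  case Succ
  then show ?thesis using just by (simp add: justified_def computes.succ)
next
  case Fst
  then show ?thesis using just by (simp add: justified_def computes.fst)
next
  case Snd
  then show ?thesis using just by (simp add: justified_def computes.snd)
next
  case Query
  then show ?thesis using just computes.query[of no_oracle x] by (simp add: justified_def)
next
  case (Tuple p1 p2)
  then have "computes no_oracle p1 x (pi1 y)" "computes no_oracle p2 x (pi2 y)"
    using just by (auto simp: justified_def intro: S)
  from computes.tuple[OF this] show ?thesis by (simp add: Tuple)
next
  case (Compose p1 p2)
  then show ?thesis
    using just by (auto simp: justified_def intro: S computes.compose)
next
  case (PrimRec p1 p2)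
  show ?thesis
  proof (cases "pi2 x")
    case 0
    then have "computes no_oracle p1 (pi1 x) y"
      using just PrimRec by (auto simp: justified_def intro: S)
    from computes.primrec_0[OF this, of p2] show ?thesis
      using 0 by (metis PrimRec prod.collapse prod_decode_inverse)
  next
    case (Suc n)
    then obtain z where "judgement (encode_recfun p) (prod_encode (pi1 x, n)) z \<in> S"
      and "judgement (encode_recfun p2) (prod_encode (pi1 x, prod_encode (n, z))) y \<in> S"
      using just PrimRec by (auto simp: justified_def)
    from this[THEN S] show ?thesis
      using computes.primrec_Suc[of no_oracle p1 p2 "pi1 x" n z y] Suc
      by (metis PrimRec prod.collapse prod_decode_inverse)
  qed
next
  case (Mu p1)
  show ?thesis
    unfolding Mu
  proof (rule computes.mu)
    show "computes no_oracle p1 (prod_encode (x, y)) 0"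
      using just Mu by (auto simp: justified_def intro: S)
    show "\<exists>v. computes no_oracle p1 (prod_encode (x, m)) (Suc v)" if "m < y" for m
      using just Mu that by (auto simp: justified_def) (blast intro: S)
  qed
qed

lemma valid_derivation_sound:
  "valid_derivation ts \<Longrightarrow> judgement (encode_recfun p) x y \<in> set ts \<Longrightarrow> computes no_oracle p x y"
proof (induction ts arbitrary: p x y)
  case (Cons t ts)
  then show ?case
    using justified_sound[of "set ts" p x y] by (metis fst_conv prod_encode_inverse set_ConsD snd_conv
        valid_derivation.simps(2))
qed simp

lemma valid_derivation_append:
  "valid_derivation xs \<Longrightarrow> valid_derivation ys \<Longrightarrow> valid_derivation (xs @ ys)"
  by (induction xs) (auto elim: justified_mono)

lemma valid_derivation_step:
  "valid_derivation ts \<Longrightarrow> justified (set ts) e x y \<Longrightarrow>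
    \<exists>us. valid_derivation us \<and> judgement e x y \<in> set us"
  by (intro exI[of _ "judgement e x y # ts"]) simp

text \<open>The rule for \<open>Mu\<close> has a premise for every smaller argument; their
  derivations must be merged into one finite derivation.\<close>

lemma valid_derivation_bounded_collect:
  fixes J :: "nat \<Rightarrow> nat \<Rightarrow> nat"
  assumes "\<And>m. m < n \<Longrightarrow> \<exists>v ts. valid_derivation ts \<and> J m v \<in> set ts"
  shows "\<exists>ts. valid_derivation ts \<and> (\<forall>m<n. \<exists>v. J m v \<in> set ts)"
  using assms
proof (induction n)
  case 0
  show ?case by (intro exI[of _ "[]"]) simp
next
  case (Suc n)
  then obtain ts where ts: "valid_derivation ts" "\<forall>m<n. \<exists>v. J m v \<in> set ts"
    by (meson less_SucI)
  from Suc.prems obtain v us where us: "valid_derivation us" "J n v \<in> set us"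
    by blast
  from ts us show ?case
    by (intro exI[of _ "ts @ us"]) (auto simp: less_Suc_eq intro: valid_derivation_append)
qed

lemma valid_derivation_complete:
  "computes no_oracle p x y \<Longrightarrow> \<exists>ts. valid_derivation ts \<and> judgement (encode_recfun p) x y \<in> set ts"
proof (induction rule: computes.induct)
  case (tuple p x y q z)
  then obtain ts us where "valid_derivation ts" "judgement (encode_recfun p) x y \<in> set ts"
    "valid_derivation us" "judgement (encode_recfun q) x z \<in> set us" by blast
  then show ?case
    by (intro valid_derivation_step[of "ts @ us"] valid_derivation_append)
      (auto simp: justified_def)
next
  case (compose q x y p z)
  then obtain ts us where "valid_derivation ts" "judgement (encode_recfun q) x y \<in> set ts"
    "valid_derivation us" "judgement (encode_recfun p) y z \<in> set us" by blast
  then show ?case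
    by (intro valid_derivation_step[of "ts @ us"] valid_derivation_append)
      (auto simp: justified_def)
next
  case (primrec_0 p x y q)
  then obtain ts where "valid_derivation ts" "judgement (encode_recfun p) x y \<in> set ts" by blast
  then show ?case
    by (intro valid_derivation_step[of ts]) (auto simp: justified_def)
next
  case (primrec_Suc p q x n y z)
  then obtain ts us where
    "valid_derivation ts" "judgement (encode_recfun (PrimRec p q)) (prod_encode (x, n)) y \<in> set ts"
    "valid_derivation us" "judgement (encode_recfun q) (prod_encode (x, prod_encode (n, y))) z \<in> set us"
    by blast
  then show ?case
    by (intro valid_derivation_step[of "ts @ us"] valid_derivation_append)
      (auto simp: justified_def)
next
  case (mu p x n)
  then obtain ts where ts: "valid_derivation ts"
    "judgement (encode_recfun p) (prod_encode (x, n)) 0 \<in> set ts" by blast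
  have "\<exists>us. valid_derivation us \<and>
      (\<forall>m<n. \<exists>v. judgement (encode_recfun p) (prod_encode (x, m)) (Suc v) \<in> set us)"
    using mu.IH(2) by (intro valid_derivation_bounded_collect) blast
  then obtain us where us: "valid_derivation us"
    "\<forall>m<n. \<exists>v. judgement (encode_recfun p) (prod_encode (x, m)) (Suc v) \<in> set us" by blast
  from us(2) have "justified (set (ts @ us)) (encode_recfun (Mu p)) x n"
    unfolding justified_def using ts(2) by (intro disjI2 conjI) auto
  then show ?case
    using ts us by (intro valid_derivation_step[of "ts @ us"] valid_derivation_append)
qed (auto intro!: valid_derivation_step[of "[]"] simp: justified_def)

text \<open>The bound on the output is essential later: a row whose index certifies a computation
  lies beyond the computed value.\<close>

lemma halting_certificate_sound:
  assumes "halting_certificate (encode_recfun p) x c"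
  shows "\<exists>y<c. computes no_oracle p x y"
proof -
  from assms obtain y where y: "judgement (encode_recfun p) x y \<in> set (list_decode c)"
    "valid_derivation (list_decode c)"
    unfolding halting_certificate_def by blast
  have "y \<le> judgement (encode_recfun p) x y"
    using le_prod_encode_2[of "prod_encode (x, y)" "encode_recfun p"] le_prod_encode_2[of y x] by linarith
  also have "\<dots> < list_encode (list_decode c)"
    using y(1) by (rule elem_less_list_encode)
  finally show ?thesis
    using valid_derivation_sound[OF y(2,1)] by auto
qed

text \<open>Padding by a trivially justified judgement makes certificates arbitrarily large; a bet
  needs one beyond the row of the previous bet.\<close>

lemma halting_certificate_complete:
  assumes "computes no_oracle p x y"
  shows "\<exists>c>m. halting_certificate (encode_recfun p) x c"
proof -
  from valid_derivation_complete[OF assms] obtain ts where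
    ts: "valid_derivation ts" "judgement (encode_recfun p) x y \<in> set ts" by blast
  define us where "us = replicate (Suc m) (judgement 0 0 0) @ ts"
  have "valid_derivation (replicate k (judgement 0 0 0))" for k
    by (induction k) (auto simp: justified_def)
  with ts have "valid_derivation us"
    unfolding us_def by (intro valid_derivation_append)
  moreover have "m < list_encode us"
    using length_le_list_encode[of us] by (simp add: us_def)
  ultimately show ?thesis
    using ts(2) by (intro exI[of _ "list_encode us"]) (auto simp: halting_certificate_def us_def)
qed

lemma halting_certificate_iff:
  "(\<exists>c. halting_certificate (encode_recfun p) x c) \<longleftrightarrow> (\<exists>y. computes no_oracle p x y)"
  using halting_certificate_sound halting_certificate_complete by blast

lemma not_halting_certificate_0 [simp]: "\<not> halting_certificate e x 0"
  by (simp add: halting_certificate_def)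

lemma judgement_mem_less: "judgement e x y \<in> set (list_decode c) \<Longrightarrow> y < c"
  using elem_less_list_encode[of "judgement e x y" "list_decode c"]
    le_prod_encode_2[of "prod_encode (x, y)" e] le_prod_encode_2[of y x] by simp

text \<open>Outputs recorded in a derivation are smaller than its code, so intermediate values can
  be searched for below \<open>c\<close>, which makes the rules decidable.\<close>

lemma justified_list_decode:
  "justified (set (list_decode c)) e x y \<longleftrightarrow>
     (let S = set (list_decode c) in
     pi1 e = 0 \<and> y = 0 \<or>
     pi1 e = 1 \<and> y = Suc x \<or>
     pi1 e = 2 \<and> y = pi1 x \<or>
     pi1 e = 3 \<and> y = pi2 x \<or>
     pi1 e = 4 \<and> y = 0 \<or>
     pi1 e = 5 \<and> judgement (pi1 (pi2 e)) x (pi1 y) \<in> S \<and> judgement (pi2 (pi2 e)) x (pi2 y) \<in> S \<or>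
     pi1 e = 6 \<and> (\<exists>z<c. judgement (pi2 (pi2 e)) x z \<in> S \<and> judgement (pi1 (pi2 e)) z y \<in> S) \<or>
     pi1 e = 7 \<and> pi2 x = 0 \<and> judgement (pi1 (pi2 e)) (pi1 x) y \<in> S \<or>
     pi1 e = 7 \<and> pi2 x \<noteq> 0 \<and>
       (\<exists>z<c. judgement e (prod_encode (pi1 x, pi2 x - 1)) z \<in> S \<and>
          judgement (pi2 (pi2 e)) (prod_encode (pi1 x, prod_encode (pi2 x - 1, z))) y \<in> S) \<or>
     pi1 e = 8 \<and> judgement (pi2 e) (prod_encode (x, y)) 0 \<in> S \<and>
       (\<forall>m<y. \<exists>v<c. judgement (pi2 e) (prod_encode (x, m)) (Suc v) \<in> S))"
proof -
  have *: "(\<exists>z. judgement a b z \<in> set (list_decode c) \<and> P z) \<longleftrightarrow>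
      (\<exists>z<c. judgement a b z \<in> set (list_decode c) \<and> P z)" for a b P
    using judgement_mem_less by blast
  have **: "(\<exists>v. judgement a b (Suc v) \<in> set (list_decode c)) \<longleftrightarrow>
      (\<exists>v<c. judgement a b (Suc v) \<in> set (list_decode c))" for a b
    using judgement_mem_less Suc_lessD by blast
  show ?thesis
    unfolding justified_def Let_def by (simp only: * **)
qed

lemma decidable_justified:
  assumes c: "computable_over \<O> c" and e: "computable_over \<O> e"
    and x: "computable_over \<O> x" and y: "computable_over \<O> y"
  shows "decidable_over \<O> (\<lambda>A z. justified (set (list_decode (c A z))) (e A z) (x A z) (y A z))"
  unfolding justified_list_decode Let_def
  by (intro computable_intros decidable_mem_list_decode assms
      computable_compose[OF c] computable_compose[OF e] computable_compose[OF x] computable_compose[OF y])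

lemma valid_derivation_iff:
  "valid_derivation (list_decode c) \<longleftrightarrow>
     (\<forall>i<c. drop_code c i \<noteq> 0 \<longrightarrow>
        justified (set (list_decode (drop_code c (Suc i))))
          (pi1 (nth_code c i)) (pi1 (pi2 (nth_code c i))) (pi2 (pi2 (nth_code c i))))"
proof -
  obtain xs where c: "c = list_encode xs"
    by (metis list_decode_inverse)
  have 1: "0 < list_encode (drop i xs) \<longleftrightarrow> i < length xs" for i
    by (metis drop_eq_Nil gr0I list_encode.simps(1) list_encode_eq not_le less_irrefl)
  have 2: "i < list_encode xs" if "i < length xs" for i
    using that length_le_list_encode[of xs] by linarith
  have "valid_derivation xs \<longleftrightarrow> (\<forall>i<length xs. justified (set (drop (Suc i) xs))
      (pi1 (xs ! i)) (pi1 (pi2 (xs ! i))) (pi2 (pi2 (xs ! i))))"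
    by (induction xs) (simp_all add: All_less_Suc2)
  then show ?thesis
    unfolding c using 2 by (auto simp: 1 nth_code_list_encode drop_code_list_encode)
qed

lemma decidable_halting_certificate:
  assumes e: "computable_over \<O> e" and x: "computable_over \<O> x" and c: "computable_over \<O> c"
  shows "decidable_over \<O> (\<lambda>A z. halting_certificate (e A z) (x A z) (c A z))"
proof -
  have *: "(\<exists>y. judgement a b y \<in> set (list_decode d)) \<longleftrightarrow>
      (\<exists>y<d. judgement a b y \<in> set (list_decode d))" for a b d
    using judgement_mem_less by blast
  show ?thesis
    unfolding halting_certificate_def valid_derivation_iff *
    by (intro computable_intros decidable_mem_list_decode decidable_justified assms
        computable_drop_code computable_nth_code
        computable_compose[OF c] computable_compose[OF e] computable_compose[OF x])
qed


section \<open>Cantor space, finite approximations to Schnorr tests, and the space of rows\<close>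

section \<open>Finite conditions on Cantor space\<close>

definition agree :: "nat set \<Rightarrow> (nat \<Rightarrow> bool) \<Rightarrow> (nat \<Rightarrow> bool) set" where
  "agree F a = {x. \<forall>i\<in>F. x i = a i}"

definition determined_below :: "nat \<Rightarrow> (nat \<Rightarrow> bool) set \<Rightarrow> bool" where
  "determined_below N S \<longleftrightarrow> (\<forall>x y. (\<forall>i<N. x i = y i) \<longrightarrow> x \<in> S \<longrightarrow> y \<in> S)"

lemma determined_belowD: "determined_below N S \<Longrightarrow> (\<And>i. i < N \<Longrightarrow> x i = y i) \<Longrightarrow> x \<in> S \<longleftrightarrow> y \<in> S"
  unfolding determined_below_def by metis

interpretation cantor_space: sequence_space "measure_pmf (bernoulli_pmf (1 / 2))"
  by unfold_locales

interpretation cantor: prob_space cantor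
  unfolding cantor_def by unfold_locales

lemma space_cantor [simp]: "space cantor = UNIV"
  by (simp add: cantor_def space_PiM)

lemma emeasure_agree: "finite F \<Longrightarrow> emeasure cantor (agree F a) = ennreal ((1 / 2) ^ card F)"
proof -
  assume F: "finite F"
  have *: "emeasure (measure_pmf (bernoulli_pmf (1 / 2))) {b} = ennreal (1 / 2)" for b
    by (cases b) (simp_all only: emeasure_pmf_single pmf_bernoulli_True pmf_bernoulli_False, simp_all)
  have "emeasure cantor (agree F a) = (\<Prod>i\<in>F. emeasure (measure_pmf (bernoulli_pmf (1 / 2))) {a i})"
    using cantor_space.emeasure_PiM_Collect[of F "\<lambda>i. {a i}"] F
    by (simp add: cantor_def agree_def space_PiM)
  also have "\<dots> = ennreal ((1 / 2) ^ card F)"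
    unfolding * prod_constant by (simp only: ennreal_power)
  finally show ?thesis .
qed

lemma measure_agree: "finite F \<Longrightarrow> measure cantor (agree F a) = (1 / 2) ^ card F"
  by (simp add: measure_def emeasure_agree)

lemma agree_measurable [measurable, intro]: "agree F a \<in> sets cantor"
proof -
  have "agree F a = {x \<in> space cantor. \<forall>i\<in>F. x i = a i}"
    by (simp add: agree_def)
  also have "\<dots> \<in> sets cantor"
    unfolding cantor_def by measurable
  finally show ?thesis .
qed

lemma set_encode_less_power:
  assumes "A \<subseteq> {..<N}"
  shows "set_encode A < 2 ^ N"
proof -
  have "set_encode A \<le> (\<Sum>i<N. 2 ^ i)"
    unfolding set_encode_def using assms by (intro sum_mono2) auto
  also have "\<dots> < (2::nat) ^ N"
    by (induction N) auto
  finally show ?thesis .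
qed

lemma set_decode_subset: "b < 2 ^ N \<Longrightarrow> set_decode b \<subseteq> {..<N}"
proof
  fix i assume b: "b < 2 ^ N" and i: "i \<in> set_decode b"
  then have "b div 2 ^ i \<noteq> 0"
    by (metis even_zero mem_Collect_eq set_decode_def)
  then have "2 ^ i \<le> b"
    by (simp add: div_eq_0_iff)
  with b have "(2::nat) ^ i < 2 ^ N"
    by linarith
  then show "i \<in> {..<N}"
    by simp
qed

lemma determined_below_decompose:
  assumes "determined_below N S"
  shows "S = (\<Union>b\<in>{b. b < 2 ^ N \<and> (\<lambda>i. i \<in> set_decode b) \<in> S}. agree {..<N} (\<lambda>i. i \<in> set_decode b))"
    (is "S = ?T")
proof (intro equalityI subsetI)
  fix x assume x: "x \<in> S"
  define b where "b = set_encode {i. i < N \<and> x i}"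
  have "b < 2 ^ N"
    unfolding b_def by (intro set_encode_less_power) auto
  moreover have dec: "i \<in> set_decode b \<longleftrightarrow> i < N \<and> x i" for i
    unfolding b_def by (subst set_encode_inverse) auto
  then have "(\<lambda>i. i \<in> set_decode b) \<in> S"
    using determined_belowD[OF assms, of x "\<lambda>i. i \<in> set_decode b"] x by simp
  moreover have "x \<in> agree {..<N} (\<lambda>i. i \<in> set_decode b)"
    by (simp add: agree_def dec)
  ultimately show "x \<in> ?T" by blast
next
  fix x assume "x \<in> ?T"
  then obtain b where "(\<lambda>i. i \<in> set_decode b) \<in> S" "x \<in> agree {..<N} (\<lambda>i. i \<in> set_decode b)"
    by blast
  then show "x \<in> S"
    using determined_belowD[OF assms, of x "\<lambda>i. i \<in> set_decode b"] by (simp add: agree_def)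
qed

lemma determined_below_measurable: "determined_below N S \<Longrightarrow> S \<in> sets cantor"
  by (subst determined_below_decompose, assumption) (intro sets.finite_UN, auto)

text \<open>The sets \<open>set_decode b\<close> with \<open>b < 2 ^ N\<close> run through all
  patterns of \<open>N\<close> bits, so the measure becomes a count that a program can carry
  out.\<close>

lemma measure_determined_below:
  assumes "determined_below N S"
  shows "measure cantor S = (\<Sum>b<2 ^ N. of_bool ((\<lambda>i. i \<in> set_decode b) \<in> S)) / 2 ^ N"
proof -
  define B where "B = {b. b < (2::nat) ^ N \<and> (\<lambda>i. i \<in> set_decode b) \<in> S}"
  have B: "finite B" unfolding B_def by simp
  have "disjoint_family_on (\<lambda>b. agree {..<N} (\<lambda>i. i \<in> set_decode b)) B"
  unfolding disjoint_family_on_def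
  proof (intro ballI impI)
    fix b c assume bc: "b \<in> B" "c \<in> B" "b \<noteq> c"
    then have "set_decode b \<noteq> set_decode c"
      by (metis set_decode_inverse)
    moreover have "set_decode b \<subseteq> {..<N}" "set_decode c \<subseteq> {..<N}"
      using bc by (auto simp: B_def dest!: set_decode_subset)
    ultimately show "agree {..<N} (\<lambda>i. i \<in> set_decode b) \<inter> agree {..<N} (\<lambda>i. i \<in> set_decode c) = {}"
      unfolding agree_def by auto
  qed
  then have "measure cantor (\<Union>b\<in>B. agree {..<N} (\<lambda>i. i \<in> set_decode b)) =
      (\<Sum>b\<in>B. measure cantor (agree {..<N} (\<lambda>i. i \<in> set_decode b)))"
    by (intro cantor.finite_measure_finite_Union B) auto
  also have "\<dots> = real (card B) / 2 ^ N"
    by (simp add: measure_agree power_divide)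
  also have "real (card B) = (\<Sum>b<2 ^ N. of_bool ((\<lambda>i. i \<in> set_decode b) \<in> S))"
    by (simp add: B_def of_bool_def sum.If_cases Int_def lessThan_def)
  finally show ?thesis
    using determined_below_decompose[OF assms] by (simp add: B_def)
qed

lemma decidable_mem_set_decode:
  "computable_over \<O> f \<Longrightarrow> computable_over \<O> g \<Longrightarrow>
    decidable_over \<O> (\<lambda>A x. f A x \<in> set_decode (g A x))"
  unfolding set_decode_def mem_Collect_eq odd_iff_mod_2_eq_one
  by (intro computable_intros)

section \<open>Names of rational approximations\<close>

text \<open>\<open>nat_to_rat_surj\<close> decodes both components by \<open>int_decode\<close>,
  which sends \<open>2 * a\<close> to \<open>a\<close>; so this names the fraction
  \<open>a / b\<close> without reducing it.\<close>

definition fraction_code :: "nat \<Rightarrow> nat \<Rightarrow> nat" where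
  "fraction_code a b = prod_encode (2 * a, 2 * b)"

lemma int_decode_even: "int_decode (2 * a) = int a"
  by (simp add: int_decode_def sum_decode_def)

lemma int_decode_odd: "int_decode (Suc (2 * a)) = - int a - 1"
  by (simp add: int_decode_def sum_decode_def)

lemma of_rat_fraction_code: "real_of_rat (nat_to_rat_surj (fraction_code a b)) = a / b"
  using int_decode_even[of b]
  by (cases "b = 0")
    (simp_all add: nat_to_rat_surj_def fraction_code_def int_decode_even of_rat_rat rat_number_collapse)

lemma computable_fraction_code:
  "computable_over \<O> f \<Longrightarrow> computable_over \<O> g \<Longrightarrow>
    computable_over \<O> (\<lambda>A x. fraction_code (f A x) (g A x))"
  unfolding fraction_code_def by (intro computable_intros)

text \<open>\<open>int_decode\<close> sends even codes to nonnegative and odd codes to negative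
  integers, and half the successor of a code, rounded down, is the absolute value. For different
  parities or denominator 0 the rational is at most 0; otherwise natural numbers are
  cross-multiplied.\<close>

lemma rational_le_iff:
  "real_of_rat (nat_to_rat_surj v) \<le> c / 2 ^ s + 1 / 2 ^ q \<longleftrightarrow>
     pi1 v mod 2 \<noteq> pi2 v mod 2 \<or> pi2 v = 0 \<or>
     (Suc (pi1 v) div 2) * 2 ^ (s + q) \<le> (Suc (pi2 v) div 2) * (c * 2 ^ q + 2 ^ s)"
proof -
  obtain \<alpha> \<beta> where v: "v = prod_encode (\<alpha>, \<beta>)"
    by (metis prod_decode_inverse surj_pair)
  have pos: "0 \<le> real c / 2 ^ s + 1 / 2 ^ q"
    by simp
  have cmp: "real a / real b \<le> c / 2 ^ s + 1 / 2 ^ q \<longleftrightarrow> a * 2 ^ (s + q) \<le> b * (c * 2 ^ q + 2 ^ s)"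
    if "b > 0" for a b
  proof -
    have "real a / real b \<le> c / 2 ^ s + 1 / 2 ^ q \<longleftrightarrow>
        real a * 2 ^ (s + q) \<le> real b * (c * 2 ^ q + 2 ^ s)"
      using that by (simp add: field_simps power_add)
    also have "\<dots> \<longleftrightarrow> real (a * 2 ^ (s + q)) \<le> real (b * (c * 2 ^ q + 2 ^ s))"
      by simp
    finally show ?thesis
      unfolding of_nat_le_iff .
  qed
  have rat: "real_of_rat (nat_to_rat_surj v) = real_of_int (int_decode \<alpha>) / real_of_int (int_decode \<beta>)"
    by (cases "int_decode \<beta> = 0") (simp_all add: v nat_to_rat_surj_def of_rat_rat rat_number_collapse)
  show ?thesis
  proof (cases "even \<alpha>"; cases "even \<beta>")
    assume "even \<alpha>" "even \<beta>"
    then obtain a b where ab: "\<alpha> = 2 * a" "\<beta> = 2 * b"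
      by (auto elim!: evenE)
    show ?thesis
      using cmp[of b a] pos int_decode_even[of b] unfolding rat by (cases "b = 0") (simp_all add: ab int_decode_even v)
  next
    assume "even \<alpha>" "odd \<beta>"
    then obtain a b where ab: "\<alpha> = 2 * a" "\<beta> = Suc (2 * b)"
      by (auto elim!: evenE oddE)
    have "real a / (- real b - 1) \<le> 0"
      by (simp add: divide_nonneg_neg)
    with pos have "real a / (- real b - 1) \<le> real c / 2 ^ s + 1 / 2 ^ q"
      by linarith
    then show ?thesis
      unfolding rat by (simp add: ab int_decode_even int_decode_odd v)
  next
    assume "odd \<alpha>" "even \<beta>"
    then obtain a b where ab: "\<alpha> = Suc (2 * a)" "\<beta> = 2 * b"
      by (auto elim!: evenE oddE)
    have "(- real a - 1) / real b \<le> 0"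
      by (simp add: divide_nonpos_nonneg)
    with pos have "(- real a - 1) / real b \<le> real c / 2 ^ s + 1 / 2 ^ q"
      by linarith
    then show ?thesis
      unfolding rat by (simp add: ab int_decode_even int_decode_odd v)
  next
    assume "odd \<alpha>" "odd \<beta>"
    then obtain a b where ab: "\<alpha> = Suc (2 * a)" "\<beta> = Suc (2 * b)"
      by (auto elim!: oddE)
    have "(- real a - 1) / (- real b - 1) = real (Suc a) / real (Suc b)"
      by (simp add: field_simps)
    then show ?thesis
      using cmp[of "Suc b" "Suc a"] unfolding rat
      by (simp add: ab int_decode_odd v del: of_nat_Suc)
  qed
qed

lemma decidable_rational_le:
  assumes "computable_over \<O> v" "computable_over \<O> c" "computable_over \<O> s" "computable_over \<O> q"
  shows "decidable_over \<O> (\<lambda>A x. real_of_rat (nat_to_rat_surj (v A x)) \<le> c A x / 2 ^ s A x + 1 / 2 ^ q A x)"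
  unfolding rational_le_iff by (intro computable_intros assms)

section \<open>A Schnorr test with dense rows\<close>

text \<open>The positions are entries \<open>prod_encode (s, t)\<close> of row \<open>k\<close>. The
  length gives measures that sum to \<open>2^-k\<close> over \<open>s\<close>; as the entries of
  block \<open>s\<close> are not below \<open>s\<close>, any finite condition on the row leaves late
  blocks free.\<close>

definition ones_block :: "nat \<Rightarrow> nat \<Rightarrow> (nat \<Rightarrow> bool) set" where
  "ones_block k s = {x. \<forall>t<Suc (k + s). x (prod_encode (k, prod_encode (s, t)))}"

definition ones_test :: "nat \<Rightarrow> (nat \<Rightarrow> bool) set" where
  "ones_test k = (\<Union>s. ones_block k s)"

lemma measure_ones_block: "measure cantor (ones_block k s) = (1 / 2) ^ Suc (k + s)"
proof -
  define F where "F = (\<lambda>t. prod_encode (k, prod_encode (s, t))) ` {..<Suc (k + s)}"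
  have "ones_block k s = agree F (\<lambda>_. True)"
    by (auto simp: ones_block_def agree_def F_def)
  moreover have "card F = Suc (k + s)"
    unfolding F_def by (subst card_image) (auto simp: inj_on_def)
  ultimately show ?thesis
    by (simp add: measure_agree F_def)
qed

lemma triangle_mono: "m \<le> n \<Longrightarrow> triangle m \<le> triangle n"
  unfolding triangle_def by (intro div_le_mono mult_le_mono) auto

lemma prod_encode_mono: "a \<le> a' \<Longrightarrow> b \<le> b' \<Longrightarrow> prod_encode (a, b) \<le> prod_encode (a', b')"
  unfolding prod_encode_def by (auto intro!: add_mono triangle_mono)

definition ones_bound :: "nat \<Rightarrow> nat \<Rightarrow> nat" where
  "ones_bound k m = Suc (prod_encode (k, prod_encode (m, k + m)))"

lemma ones_block_determined:
  assumes "s < m"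
  shows "determined_below (ones_bound k m) (ones_block k s)"
proof -
  have "prod_encode (k, prod_encode (s, t)) < ones_bound k m" if "t < Suc (k + s)" for t
    unfolding ones_bound_def less_Suc_eq_le using that assms by (intro prod_encode_mono) auto
  then show ?thesis
    unfolding determined_below_def ones_block_def by auto
qed

lemma determined_below_UN: "(\<And>i. i \<in> I \<Longrightarrow> determined_below N (S i)) \<Longrightarrow> determined_below N (\<Union>i\<in>I. S i)"
  unfolding determined_below_def by blast

lemma ones_block_measurable: "ones_block k s \<in> sets cantor"
  using ones_block_determined[of s "Suc s" k] by (auto intro: determined_below_measurable)

lemma measure_ones_tail: "measure cantor (\<Union>s\<in>{m..}. ones_block k s) \<le> (1 / 2) ^ (k + m)"
proof -
  have "(\<Union>s\<in>{m..}. ones_block k s) = (\<Union>s. ones_block k (s + m))"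
    by (rule set_eqI) (force simp: nat_le_iff_add add.commute)
  moreover have sums: "(\<lambda>s. measure cantor (ones_block k (s + m))) sums (1 / 2) ^ (k + m)"
    using sums_mult[OF power_half_series, of "(1 / 2) ^ (k + m)"]
    by (simp add: measure_ones_block power_add mult_ac)
  ultimately show ?thesis
    using cantor.finite_measure_subadditive_countably[of "\<lambda>s. ones_block k (s + m)"]
    by (simp add: image_subset_iff ones_block_measurable sums_iff)
qed

lemma ones_test_split: "ones_test k = (\<Union>s<m. ones_block k s) \<union> (\<Union>s\<in>{m..}. ones_block k s)"
proof -
  have "UNIV = {..<m} \<union> {m..}"
    by auto
  then show ?thesis
    unfolding ones_test_def by (metis UN_Un)
qed

lemma ones_test_approx:
  "\<bar>measure cantor (\<Union>s<m. ones_block k s) - measure cantor (ones_test k)\<bar> \<le> (1 / 2) ^ m"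
proof -
  let ?A = "\<Union>s<m. ones_block k s" and ?B = "\<Union>s\<in>{m..}. ones_block k s"
  have meas: "?A \<in> sets cantor" "?B \<in> sets cantor"
    by (auto intro!: sets.countable_UN'' simp: ones_block_measurable)
  have "measure cantor ?A \<le> measure cantor (ones_test k)"
    unfolding ones_test_split[of k m] using meas by (intro cantor.finite_measure_mono) auto
  moreover have "measure cantor (ones_test k) \<le> measure cantor ?A + measure cantor ?B"
    unfolding ones_test_split[of k m] by (intro measure_Un_le meas)
  moreover have "(1 / 2 :: real) ^ (k + m) \<le> (1 / 2) ^ m"
    by (intro power_decreasing) auto
  ultimately show ?thesis
    using measure_ones_tail[of k m] by linarith
qed

lemma computable_real_ones_test: "computable_real_seq (\<lambda>k. measure cantor (ones_test k))"
proof -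
  define N where "N z = ones_bound (pi1 z) (pi2 z)" for z
  define c where "c z = (\<Sum>b<2 ^ N z. of_bool (\<exists>s<pi2 z. \<forall>t<Suc (pi1 z + s).
      prod_encode (pi1 z, prod_encode (s, t)) \<in> set_decode b) :: nat)" for z
  have N: "computable_over {no_oracle} (\<lambda>A. N)"
    unfolding N_def ones_bound_def by (intro computable_intros)
  have c: "computable_over {no_oracle} (\<lambda>A. c)"
    unfolding c_def by (intro computable_intros N decidable_mem_set_decode)
  have "computable_over {no_oracle} (\<lambda>A z. fraction_code (c z) (2 ^ N z))"
    by (intro computable_fraction_code N c computable_intros)
  then obtain p where p: "\<And>z. computes no_oracle p z (fraction_code (c z) (2 ^ N z))"
    unfolding computable_over_def by blast
  have "real (c (prod_encode (k, m))) / 2 ^ N (prod_encode (k, m)) = measure cantor (\<Union>s<m. ones_block k s)"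
    for k m
  proof -
    have "determined_below (ones_bound k m) (\<Union>s<m. ones_block k s)"
      by (intro determined_below_UN ones_block_determined) auto
    from measure_determined_below[OF this] show ?thesis
      by (simp add: c_def N_def ones_block_def Bex_def del: sum_of_bool_eq)
  qed
  note approx = this
  have "names_real no_oracle p k (measure cantor (ones_test k))" for k
    unfolding names_real_def
  proof
    fix m
    show "\<exists>q. computes no_oracle p (prod_encode (k, m)) q \<and>
        \<bar>real_of_rat (nat_to_rat_surj q) - measure cantor (ones_test k)\<bar> \<le> (1 / 2) ^ m"
      using p[of "prod_encode (k, m)"] ones_test_approx[of k m]
        approx[of k m]
      by (intro exI[of _ "fraction_code (c (prod_encode (k, m))) (2 ^ N (prod_encode (k, m)))"] conjI)
        (simp_all add: of_rat_fraction_code)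
  qed
  then show ?thesis
    unfolding computable_real_seq_def by blast
qed

lemma cylinder_map: "cylinder (map x [0..<l]) = agree {..<l} x"
  by (auto simp: cylinder_def agree_def)

lemma effectively_open_ones_test: "effectively_open_seq ones_test"
proof -
  define P where "P z s \<longleftrightarrow> (\<forall>t<Suc (pi1 z + s).
      nth_code (pi2 z) (prod_encode (pi1 z, prod_encode (s, t))) = 1)" for z s
  have "decidable_over {no_oracle} (\<lambda>A z. P (pi1 z) (pi2 z))"
    unfolding P_def by (intro computable_intros computable_nth_code)
  then obtain p where p: "\<And>z. (\<exists>y. computes no_oracle p z y) \<longleftrightarrow> (\<exists>s. P z s)"
    using semidecidable_ex[of "{no_oracle}" "\<lambda>A. P"] by auto
  \<comment> \<open>Past the end of \<open>\<sigma>\<close> the value of \<open>nth_code\<close> is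
    0, so the comparison with 1 also checks that \<open>\<sigma>\<close> is long enough.\<close>
  have *: "P (prod_encode (k, list_encode (map of_bool \<sigma>))) s \<longleftrightarrow>
      (\<forall>t<Suc (k + s). prod_encode (k, prod_encode (s, t)) < length \<sigma> \<and>
         \<sigma> ! prod_encode (k, prod_encode (s, t)))" for k \<sigma> s
    by (auto simp: P_def nth_code_list_encode split: if_splits)
  have "ones_test k = (\<Union>\<sigma>\<in>{\<sigma>. \<exists>s. P (prod_encode (k, list_encode (map of_bool \<sigma>))) s}. cylinder \<sigma>)"
    (is "_ = ?U") for k
  proof (intro equalityI subsetI)
    fix x assume "x \<in> ones_test k"
    then obtain s where s: "x \<in> ones_block k s"
      by (auto simp: ones_test_def)
    define \<sigma> where "\<sigma> = map x [0..<ones_bound k s]"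
    have "prod_encode (k, prod_encode (s, t)) < ones_bound k s" if "t < Suc (k + s)" for t
      unfolding ones_bound_def less_Suc_eq_le using that by (intro prod_encode_mono) auto
    with s have "P (prod_encode (k, list_encode (map of_bool \<sigma>))) s"
      unfolding * \<sigma>_def ones_block_def by auto
    moreover have "x \<in> cylinder \<sigma>"
      unfolding \<sigma>_def cylinder_map by (simp add: agree_def)
    ultimately show "x \<in> ?U" by blast
  next
    fix x assume "x \<in> ?U"
    then obtain \<sigma> s where "P (prod_encode (k, list_encode (map of_bool \<sigma>))) s" "x \<in> cylinder \<sigma>"
      by blast
    then show "x \<in> ones_test k"
      unfolding * ones_test_def ones_block_def cylinder_def by auto
  qed
  then show ?thesis
    unfolding effectively_open_seq_def by (intro exI[of _ p] allI) (simp only: p)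
qed

lemma Schnorr_test_ones_test: "Schnorr_test ones_test"
  unfolding Schnorr_test_def
  using effectively_open_ones_test computable_real_ones_test measure_ones_tail[of _ 0]
  by (simp add: ones_test_def)


section \<open>Moduli of Schnorr tests\<close>

definition prefix_code :: "nat \<Rightarrow> nat \<Rightarrow> nat" where
  "prefix_code b l = list_encode (map (\<lambda>i. of_bool (i \<in> set_decode b)) [0..<l])"

text \<open>List codes grow at the front, so the recursion visits the bits from position
  \<open>l - 1\<close> down to 0.\<close>

lemma prefix_code_rec:
  "prefix_code b l =
     rec_nat 0 (\<lambda>j acc. Suc (prod_encode (of_bool (l - Suc j \<in> set_decode b), acc))) l"
proof -
  let ?f = "\<lambda>i. of_bool (i \<in> set_decode b) :: nat"
  have "rec_nat 0 (\<lambda>j acc. Suc (prod_encode (?f (l - Suc j), acc))) j = list_encode (map ?f [l - j..<l])"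
    if "j \<le> l" for j
    using that
  proof (induction j)
    case (Suc j)
    then have "[l - Suc j..<l] = (l - Suc j) # [l - j..<l]"
      by (subst upt_conv_Cons) (auto simp: Suc_diff_Suc)
    with Suc show ?case by simp
  qed simp
  from this[of l] show ?thesis
    by (simp add: prefix_code_def)
qed

lemma computable_prefix_code:
  assumes "computable_over \<O> f" and g: "computable_over \<O> g"
  shows "computable_over \<O> (\<lambda>A x. prefix_code (f A x) (g A x))"
  unfolding prefix_code_rec
  by (intro computable_rec computable_intros decidable_mem_set_decode assms
      computable_compose[OF assms(1)] computable_compose[OF g])

text \<open>The bound on \<open>l\<close> makes the set depend on the first \<open>s\<close> bits
  only, the bound on \<open>c\<close> makes membership decidable.\<close>

definition stage_sets :: "nat \<Rightarrow> nat \<Rightarrow> nat \<Rightarrow> (nat \<Rightarrow> bool) set" where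
  "stage_sets e k s = {x. \<exists>l<Suc s. \<exists>c<Suc s.
     halting_certificate e (prod_encode (k, list_encode (map (\<lambda>i. of_bool (x i)) [0..<l]))) c}"

lemma stage_sets_determined: "determined_below s (stage_sets e k s)"
proof -
  have "map (\<lambda>i. of_bool (x i) :: nat) [0..<l] = map (\<lambda>i. of_bool (y i)) [0..<l]"
    if "\<forall>i<s. x i = y i" "l < Suc s" for x y :: "nat \<Rightarrow> bool" and l
    using that by simp
  then show ?thesis
    unfolding determined_below_def stage_sets_def mem_Collect_eq by metis
qed

lemma incseq_stage_sets: "incseq (stage_sets e k)"
proof (intro monoI subsetI)
  fix s t :: nat and x
  assume "s \<le> t" "x \<in> stage_sets e k s"
  then show "x \<in> stage_sets e k t"
    unfolding stage_sets_def mem_Collect_eq by (meson Suc_le_mono less_le_trans)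
qed

lemma UN_stage_sets:
  assumes "U k = (\<Union>\<sigma> \<in> {\<sigma>. \<exists>y. computes no_oracle p
        (prod_encode (k, list_encode (map of_bool \<sigma>))) y}. cylinder \<sigma>)"
  shows "U k = (\<Union>s. stage_sets (encode_recfun p) k s)"
proof (intro equalityI subsetI)
  fix x assume "x \<in> U k"
  then obtain \<sigma> where \<sigma>: "\<exists>y. computes no_oracle p (prod_encode (k, list_encode (map of_bool \<sigma>))) y"
    "x \<in> cylinder \<sigma>"
    unfolding assms by blast
  then obtain c where "halting_certificate (encode_recfun p) (prod_encode (k, list_encode (map of_bool \<sigma>))) c"
    by (auto simp: halting_certificate_iff[symmetric])
  moreover have "map of_bool \<sigma> = map (\<lambda>i. of_bool (x i)) [0..<length \<sigma>]"
    using \<sigma>(2) by (intro nth_equalityI) (auto simp: cylinder_def)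
  ultimately have "x \<in> stage_sets (encode_recfun p) k (length \<sigma> + c)"
    unfolding stage_sets_def mem_Collect_eq by (metis le_add1 le_add2 le_imp_less_Suc)
  then show "x \<in> (\<Union>s. stage_sets (encode_recfun p) k s)"
    by blast
next
  fix x assume "x \<in> (\<Union>s. stage_sets (encode_recfun p) k s)"
  then obtain l where "\<exists>c. halting_certificate (encode_recfun p)
      (prod_encode (k, list_encode (map (\<lambda>i. of_bool (x i)) [0..<l]))) c"
    unfolding stage_sets_def by blast
  then have "\<exists>y. computes no_oracle p (prod_encode (k, list_encode (map of_bool (map x [0..<l])))) y"
    unfolding halting_certificate_iff by (simp add: comp_def)
  moreover have "x \<in> cylinder (map x [0..<l])"
    by (simp add: cylinder_def)
  ultimately show "x \<in> U k"
    unfolding assms by blast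
qed

text \<open>
  The search for a stage tolerates an error of \<open>2^-(x+1)\<close> but reads the measure of \<open>U k\<close> with
  precision \<open>2^-(x+2)\<close>; the margin between the two guarantees that it halts.
\<close>

lemma Schnorr_test_modulus:
  assumes "Schnorr_test U"
  shows "\<exists>h W. computable_over {no_oracle} (\<lambda>A. h) \<and>
    (\<forall>k s. determined_below s (W k s)) \<and> (\<forall>k. U k = (\<Union>s. W k s)) \<and>
    (\<forall>k x s. k \<le> x \<longrightarrow> h x \<le> s \<longrightarrow>
       measure cantor (U k) - measure cantor (W k s) \<le> (1 / 2) ^ x)"
proof -
  obtain p where p: "\<And>k. U k = (\<Union>\<sigma> \<in> {\<sigma>. \<exists>y. computes no_oracle p
        (prod_encode (k, list_encode (map of_bool \<sigma>))) y}. cylinder \<sigma>)"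
    using assms unfolding Schnorr_test_def effectively_open_seq_def by blast
  obtain q where "\<And>k. names_real no_oracle q k (measure cantor (U k))"
    using assms unfolding Schnorr_test_def computable_real_seq_def by blast
  then obtain v where v: "\<And>z. computes no_oracle q z (v z)"
    and approx: "\<And>k m. \<bar>real_of_rat (nat_to_rat_surj (v (prod_encode (k, m)))) - measure cantor (U k)\<bar> \<le> (1 / 2) ^ m"
    unfolding names_real_def
  proof -
    assume *: "\<And>k. \<forall>m. \<exists>n. computes no_oracle q (prod_encode (k, m)) n \<and>
       \<bar>real_of_rat (nat_to_rat_surj n) - measure cantor (U k)\<bar> \<le> (1 / 2) ^ m"
    have "\<exists>n. computes no_oracle q z n \<and>
       \<bar>real_of_rat (nat_to_rat_surj n) - measure cantor (U (pi1 z))\<bar> \<le> (1 / 2) ^ pi2 z" for z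
      using *[of "pi1 z", rule_format, of "pi2 z"] by simp
    then obtain v where "\<And>z. computes no_oracle q z (v z) \<and>
       \<bar>real_of_rat (nat_to_rat_surj (v z)) - measure cantor (U (pi1 z))\<bar> \<le> (1 / 2) ^ pi2 z"
      by metis
    then show thesis
      by (intro that[of v]) (auto dest: spec, metis fst_conv prod_encode_inverse snd_conv)
  qed
  define W where "W = stage_sets (encode_recfun p)"
  have W: "determined_below s (W k s)" "U k = (\<Union>s. W k s)" "incseq (W k)" for k s
    unfolding W_def using stage_sets_determined incseq_stage_sets UN_stage_sets p by auto
  have W_sets: "W k s \<in> sets cantor" for k s
    using W(1) by (rule determined_below_measurable)
  define count where "count z s = (\<Sum>b<2 ^ s. of_bool (\<exists>l<Suc s. \<exists>c<Suc s.
     halting_certificate (encode_recfun p) (prod_encode (pi1 z, prefix_code b l)) c) :: nat)" for z s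
  have count: "measure cantor (W k s) = real (count (prod_encode (k, x)) s) / 2 ^ s" for k s x
    unfolding measure_determined_below[OF W(1)]
    by (simp add: W_def stage_sets_def count_def prefix_code_def Bex_def del: sum_of_bool_eq)
  define P where "P z s \<longleftrightarrow> real_of_rat (nat_to_rat_surj (v (prod_encode (pi1 z, Suc (Suc (pi2 z))))))
      \<le> count z s / 2 ^ s + 1 / 2 ^ Suc (pi2 z)" for z s
  have "computable_over {no_oracle} (\<lambda>A. v)"
    using v by (intro computable_overI) auto
  note v' = computable_compose[OF this]
  have "computable_over {no_oracle} (\<lambda>A z. count (pi1 z) (pi2 z))"
    unfolding count_def by (intro computable_intros decidable_halting_certificate computable_prefix_code)
  then have "decidable_over {no_oracle} (\<lambda>A z. P (pi1 z) (pi2 z))"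
    unfolding P_def by (intro decidable_rational_le v' computable_intros)
  moreover have ex: "\<exists>s. P z s" for z
  proof -
    define k where "k = pi1 z"
    define x where "x = pi2 z"
    have z: "z = prod_encode (k, x)"
      by (simp add: k_def x_def)
    have "(\<lambda>s. measure cantor (W k s)) \<longlonglongrightarrow> measure cantor (U k)"
      unfolding W(2)[of k] using W_sets W(3) by (intro cantor.finite_Lim_measure_incseq) auto
    then have "eventually (\<lambda>s. measure cantor (U k) - (1 / 2) ^ Suc (Suc x) < measure cantor (W k s)) sequentially"
      by (rule order_tendstoD) simp
    then obtain s where "measure cantor (U k) - (1 / 2) ^ Suc (Suc x) < measure cantor (W k s)"
      by (auto simp: eventually_sequentially)
    moreover have "real_of_rat (nat_to_rat_surj (v (prod_encode (k, Suc (Suc x)))))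
        \<le> measure cantor (U k) + (1 / 2) ^ Suc (Suc x)"
      using approx[of k "Suc (Suc x)"] by linarith
    ultimately have "P z s"
      unfolding P_def z by (simp add: count[of k s x, symmetric] power_one_over) 
    then show ?thesis ..
  qed
  ultimately have "computable_over {no_oracle} (\<lambda>A z. LEAST s. P z s)"
    by (intro computable_Least) auto
  note h0 = computable_compose[OF this]
  \<comment> \<open>Summing over all \<open>k \<le> x\<close> lets one value serve every level up to
    \<open>x\<close>, so the modulus need not know at which level the test will be used.\<close>
  define h where "h x = (\<Sum>k<Suc x. LEAST s. P (prod_encode (k, x)) s)" for x
  have "computable_over {no_oracle} (\<lambda>A. h)"
    unfolding h_def by (intro computable_intros h0)
  moreover have "measure cantor (U k) - measure cantor (W k s) \<le> (1 / 2) ^ x" if "k \<le> x" "h x \<le> s" for k x s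
  proof -
    define t where "t = (LEAST s. P (prod_encode (k, x)) s)"
    have "t \<le> h x"
      unfolding h_def t_def
      by (rule member_le_sum[of k "{..<Suc x}" "\<lambda>k. LEAST s. P (prod_encode (k, x)) s"]) (use that in auto)
    with that have "W k t \<subseteq> W k s"
      using W(3) by (meson incseqD le_trans)
    then have "measure cantor (W k t) \<le> measure cantor (W k s)"
      using W_sets by (intro cantor.finite_measure_mono)
    moreover have "P (prod_encode (k, x)) t"
      unfolding t_def using ex by (rule LeastI_ex)
    then have "real_of_rat (nat_to_rat_surj (v (prod_encode (k, Suc (Suc x))))) \<le>
        measure cantor (W k t) + 1 / 2 ^ Suc x"
      by (simp add: P_def count[of k t x])
    moreover have "measure cantor (U k) \<le>
        real_of_rat (nat_to_rat_surj (v (prod_encode (k, Suc (Suc x))))) + (1 / 2) ^ Suc (Suc x)"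
      using approx[of k "Suc (Suc x)"] by linarith
    moreover have "(1 / 2 :: real) ^ Suc (Suc x) + 1 / 2 ^ Suc x \<le> (1 / 2) ^ x"
      by (simp add: power_one_over field_simps)
    ultimately show ?thesis by linarith
  qed
  ultimately show ?thesis
    using W(1,2) by blast
qed


section \<open>The space of rows\<close>

interpretation row_space: sequence_space cantor
  rewrites "Pi\<^sub>M UNIV (\<lambda>_. cantor) = rows"
  by unfold_locales (simp add: rows_def)

lemma space_rows [simp]: "space rows = UNIV"
  by (simp add: rows_def space_PiM)

lemma measure_rows_UNIV [simp]: "measure rows UNIV = 1"
  using row_space.P.prob_space by simp

lemma measurable_row [measurable]: "(\<lambda>\<omega>. \<omega> m) \<in> measurable rows cantor"
  unfolding rows_def by measurable

lemma measurable_entry [measurable]: "(\<lambda>x. x j) \<in> measurable cantor (count_space UNIV)"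
  unfolding cantor_def by measurable

lemma measurable_comb_seq_right [measurable]: "comb_seq n \<omega> \<in> measurable rows rows"
  unfolding rows_def
  by (rule measurable_comb_seq'[where f = "\<lambda>_. \<omega>", unfolded eta_contract_eq])
    (auto simp: space_PiM)

lemma comb_seq_comb_seq: "comb_seq n (comb_seq m \<omega> \<xi>) \<xi>' = comb_seq m \<omega> (comb_seq (n - m) \<xi> \<xi>')"
  if "m \<le> n"
  using that by (auto simp: comb_seq_def fun_eq_iff)

text \<open>Splicing two independent samples of \<open>rows\<close> yields a sample of
  \<open>rows\<close> again, so the claim is Fubini's theorem; the bound on \<open>g\<close>
  provides integrability.\<close>

lemma cond_expect_tower:
  assumes [measurable]: "g \<in> borel_measurable rows" and bound: "\<And>\<omega>. \<bar>g \<omega>\<bar> \<le> B" and "m \<le> n"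
  shows "cond_expect m (cond_expect n g) \<omega> = cond_expect m g \<omega>"
proof -
  have pair: "(\<lambda>(\<xi>, \<xi>'). comb_seq (n - m) \<xi> \<xi>') \<in> measurable (rows \<Otimes>\<^sub>M rows) rows"
    using measurable_comb_seq[of "n - m" cantor] by (simp add: rows_def)
  interpret P: pair_prob_space rows rows ..
  have meas: "(\<lambda>(\<xi>, \<xi>'). g (comb_seq m \<omega> (comb_seq (n - m) \<xi> \<xi>'))) \<in> borel_measurable (rows \<Otimes>\<^sub>M rows)"
    using measurable_compose[OF pair, of "\<lambda>\<xi>. g (comb_seq m \<omega> \<xi>)"] by (simp add: case_prod_beta')
  have "cond_expect m g \<omega> = (\<integral>\<xi>. g (comb_seq m \<omega> \<xi>) \<partial>distr (rows \<Otimes>\<^sub>M rows) rows (\<lambda>(\<xi>, \<xi>'). comb_seq (n - m) \<xi> \<xi>'))"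
    unfolding cond_expect_def row_space.PiM_comb_seq ..
  also have "\<dots> = (\<integral>p. (case p of (\<xi>, \<xi>') \<Rightarrow> g (comb_seq m \<omega> (comb_seq (n - m) \<xi> \<xi>'))) \<partial>(rows \<Otimes>\<^sub>M rows))"
    using pair by (subst integral_distr) (auto simp: case_prod_beta')
  also have "\<dots> = (\<integral>\<xi>. \<integral>\<xi>'. g (comb_seq m \<omega> (comb_seq (n - m) \<xi> \<xi>')) \<partial>rows \<partial>rows)"
    using meas bound
    by (subst P.integral_fst[symmetric]) (auto intro!: P.integrable_const_bound[where B = B])
  also have "\<dots> = cond_expect m (cond_expect n g) \<omega>"
    unfolding cond_expect_def comb_seq_comb_seq[OF \<open>m \<le> n\<close>] ..
  finally show ?thesis ..
qed

section \<open>A Schnorr random sequence on which a betting martingale is unbounded\<close>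

section \<open>A martingale betting on halting certificates\<close>

text \<open>
  The state after \<open>n\<close> rows is a pair of the current capital and the last row \<open>x\<close> on which a bet
  was placed (initially 0).  The initial run of ones in row \<open>x\<close>, not counting entry 0, is
  a program; the next bet is on entry 0 of the first row \<open>n\<close> that certifies its halting on input \<open>x\<close>.
\<close>

definition run_length :: "(nat \<Rightarrow> nat) \<Rightarrow> nat \<Rightarrow> nat" where
  "run_length A x = (\<Sum>j<x. of_bool (\<forall>l<Suc j. A (prod_encode (x, Suc l)) \<noteq> 0))"

definition bet_step :: "(nat \<Rightarrow> nat) \<Rightarrow> nat \<Rightarrow> nat \<Rightarrow> nat" where
  "bet_step A n s =
     (if halting_certificate (run_length A (pi2 s)) (pi2 s) n
      then prod_encode (2 * pi1 s * of_bool (A (prod_encode (n, 0)) \<noteq> 0), n) else s)"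

definition bet_state :: "(nat \<Rightarrow> nat) \<Rightarrow> nat \<Rightarrow> nat" where
  "bet_state A n = rec_nat (prod_encode (1, 0)) (bet_step A) n"

abbreviation entries :: "(nat \<Rightarrow> nat \<Rightarrow> bool) \<Rightarrow> nat \<Rightarrow> nat" where
  "entries \<omega> k \<equiv> of_bool (join_rows \<omega> k)"

definition capital :: "nat \<Rightarrow> (nat \<Rightarrow> nat \<Rightarrow> bool) \<Rightarrow> real" where
  "capital n \<omega> = real (pi1 (bet_state (entries \<omega>) n))"

lemma bet_state_0 [simp]: "bet_state A 0 = prod_encode (1, 0)"
  by (simp add: bet_state_def)

lemma bet_state_Suc [simp]: "bet_state A (Suc n) = bet_step A n (bet_state A n)"
  by (simp add: bet_state_def)

lemma join_rows_prod_encode [simp]: "join_rows \<omega> (prod_encode (m, j)) = \<omega> m j"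
  by (simp add: join_rows_def)

text \<open>The state thus refers to a row already seen, or to row 0, whose run is an empty sum;
  hence the capital after \<open>n\<close> rows depends on these rows only.\<close>

lemma last_bet: "pi2 (bet_state A n) < n \<or> pi2 (bet_state A n) = 0"
proof (induction n)
  case (Suc n)
  then show ?case by (auto simp: bet_step_def)
qed simp

lemma run_length_cong:
  "(\<And>m j. m < n \<Longrightarrow> A (prod_encode (m, j)) = B (prod_encode (m, j))) \<Longrightarrow>
    x < n \<or> x = 0 \<Longrightarrow> run_length A x = run_length B x"
  by (auto simp: run_length_def)

lemma bet_state_cong:
  "(\<And>m j. m < n \<Longrightarrow> A (prod_encode (m, j)) = B (prod_encode (m, j))) \<Longrightarrow> bet_state A n = bet_state B n"
proof (induction n)
  case (Suc n)
  then have eq: "bet_state A n = bet_state B n"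
    by simp
  moreover have "run_length A (pi2 (bet_state B n)) = run_length B (pi2 (bet_state B n))"
    using last_bet[of B n] Suc.prems by (intro run_length_cong[of n]) auto
  ultimately show ?case
    using Suc.prems by (simp add: bet_step_def)
qed simp

lemma capital_rows_oracle:
  "capital n \<omega> = real (pi1 (bet_state (rows_oracle (initial_rows n \<omega>)) n))"
  unfolding capital_def
  by (subst bet_state_cong[of n _ "rows_oracle (initial_rows n \<omega>)"])
    (auto simp: rows_oracle_def initial_rows_def)

lemma computable_bet_state:
  "computable_over \<O> f \<Longrightarrow> computable_over \<O> (\<lambda>A x. bet_state A (f A x))"
  unfolding bet_state_def bet_step_def run_length_def
  by (intro computable_rec computable_intros decidable_halting_certificate)

lemma capital_names:
  "\<exists>p. \<forall>n \<omega>. names_real (rows_oracle (initial_rows n \<omega>)) p n (capital n \<omega>)"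
proof -
  have "computable_over UNIV (\<lambda>A z. fraction_code (pi1 (bet_state A (pi1 z))) 1)"
    by (intro computable_fraction_code computable_bet_state computable_intros)
  then obtain p where p: "\<And>A z. computes A p z (fraction_code (pi1 (bet_state A (pi1 z))) 1)"
    unfolding computable_over_def by blast
  have "names_real (rows_oracle (initial_rows n \<omega>)) p n (capital n \<omega>)" for n \<omega>
    unfolding names_real_def
  proof
    fix k
    show "\<exists>q. computes (rows_oracle (initial_rows n \<omega>)) p (prod_encode (n, k)) q \<and>
        \<bar>real_of_rat (nat_to_rat_surj q) - capital n \<omega>\<bar> \<le> (1 / 2) ^ k"
      using p[of "rows_oracle (initial_rows n \<omega>)" "prod_encode (n, k)"]
      by (intro exI conjI) (auto simp: of_rat_fraction_code capital_rows_oracle)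
  qed
  then show ?thesis by blast
qed

lemma measurable_count_space2:
  fixes f g :: "'a \<Rightarrow> nat"
  assumes "f \<in> measurable M (count_space UNIV)" "g \<in> measurable M (count_space UNIV)"
  shows "(\<lambda>x. h (f x) (g x)) \<in> measurable M (count_space UNIV)"
  by (rule measurable_compose_countable[OF _ assms(1)], rule measurable_compose[OF assms(2)]) simp

lemma measurable_entries [measurable]: "(\<lambda>\<omega>. entries \<omega> k) \<in> measurable rows (count_space UNIV)"
  unfolding join_rows_def case_prod_beta' by measurable

lemma measurable_run_length: "(\<lambda>\<omega>. run_length (entries \<omega>) x) \<in> measurable rows (count_space UNIV)"
proof -
  have "(\<lambda>\<omega>. \<Sum>j<y. of_bool (\<forall>l<Suc j. entries \<omega> (prod_encode (x, Suc l)) \<noteq> 0) :: nat)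
      \<in> measurable rows (count_space UNIV)" for y
  proof (induction y)
    case (Suc y)
    have "(\<lambda>\<omega>. of_bool (\<forall>l<Suc y. entries \<omega> (prod_encode (x, Suc l)) \<noteq> 0) :: nat)
        \<in> measurable rows (count_space UNIV)"
      by measurable
    from measurable_count_space2[OF Suc this, of "(+)"] show ?case
      by simp
  qed simp
  then show ?thesis unfolding run_length_def .
qed

lemma measurable_bet_state: "(\<lambda>\<omega>. bet_state (entries \<omega>) n) \<in> measurable rows (count_space UNIV)"
proof (induction n)
  case (Suc n)
  have "(\<lambda>\<omega>. bet_step (entries \<omega>) n s) \<in> measurable rows (count_space UNIV)" for s
    unfolding bet_step_def
    by (rule measurable_count_space2[OF measurable_run_length[of "pi2 s"] measurable_entries[of "prod_encode (n, 0)"]])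
  from measurable_compose_countable[OF this Suc] show ?case
    by simp
qed simp

lemma measurable_capital [measurable]: "capital n \<in> borel_measurable rows"
  unfolding capital_def by (rule measurable_compose[OF measurable_bet_state]) simp

lemma capital_nonneg: "0 \<le> capital n \<omega>"
  by (simp add: capital_def)

lemma capital_le: "capital n \<omega> \<le> 2 ^ n"
proof -
  have "pi1 (bet_state A n) \<le> 2 ^ n" for A
  proof (induction n)
    case (Suc n)
    then show ?case by (auto simp: bet_step_def)
  qed simp
  from this[of "entries \<omega>"] show ?thesis
    unfolding capital_def by (metis of_nat_le_iff of_nat_numeral of_nat_power)
qed

lemma integrable_capital: "integrable rows (capital n)"
  by (rule row_space.P.integrable_const_bound[where B = "2 ^ n"]) (auto simp: capital_nonneg capital_le)

lemma capital_cong: "(\<And>m. m < n \<Longrightarrow> \<omega> m = \<omega>' m) \<Longrightarrow> capital n \<omega> = capital n \<omega>'"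
  unfolding capital_def by (subst bet_state_cong[of n _ "entries \<omega>'"]) auto

lemma measure_first_entry: "measure rows {\<xi>. \<xi> 0 0} = 1 / 2"
proof -
  have "{\<xi>. \<xi> 0 0} = {\<xi> \<in> space rows. \<xi> 0 \<in> agree {0} (\<lambda>_. True)}"
    by (simp add: agree_def)
  moreover have "emeasure rows \<dots> = emeasure cantor (agree {0} (\<lambda>_. True))"
    by (rule row_space.emeasure_PiM_Collect_single) auto
  ultimately have "measure rows {\<xi>. \<xi> 0 0} = measure cantor (agree {0} (\<lambda>_. True))"
    by (simp only: measure_def)
  then show ?thesis
    by (simp add: measure_agree)
qed

text \<open>Whether row \<open>n\<close> is bet on is settled by the earlier rows, and a bet
  multiplies the capital by 2 or 0 according to one fair bit.\<close>

lemma cond_expect_capital_Suc: "cond_expect n (capital (Suc n)) \<omega> = capital n \<omega>"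
proof -
  define x where "x = pi2 (bet_state (entries \<omega>) n)"
  define bet where "bet \<longleftrightarrow> halting_certificate (run_length (entries \<omega>) x) x n"
  have "capital (Suc n) (comb_seq n \<omega> \<xi>) = capital n \<omega> * (if bet then 2 * indicator {\<xi>. \<xi> 0 0} \<xi> else 1)" for \<xi>
  proof -
    have eq: "entries (comb_seq n \<omega> \<xi>) (prod_encode (m, j)) = entries \<omega> (prod_encode (m, j))" if "m < n" for m j
      using that by (simp add: comb_seq_less)
    then have "bet_state (entries (comb_seq n \<omega> \<xi>)) n = bet_state (entries \<omega>) n"
      by (rule bet_state_cong)
    moreover have "run_length (entries (comb_seq n \<omega> \<xi>)) x = run_length (entries \<omega>) x"
      using eq last_bet[of "entries \<omega>" n] unfolding x_def by (intro run_length_cong[of n]) auto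
    moreover have "comb_seq n \<omega> \<xi> n = \<xi> 0"
      using comb_seq_add[of n \<omega> \<xi> 0] by simp
    ultimately show ?thesis
      by (simp add: capital_def bet_step_def bet_def x_def[symmetric] indicator_def)
  qed
  moreover have "(\<integral>\<xi>. (if bet then 2 * indicator {\<xi>. \<xi> 0 0} \<xi> else 1) \<partial>rows) = (1::real)"
    by (cases bet) (simp_all add: measure_first_entry)
  ultimately show ?thesis
    by (simp add: cond_expect_def)
qed

lemma cond_expect_capital: "m \<le> n \<Longrightarrow> cond_expect m (capital n) \<omega> = capital m \<omega>"
proof (induction n rule: dec_induct)
  case base
  have "capital m (comb_seq m \<omega> \<xi>) = capital m \<omega>" for \<xi>
    by (rule capital_cong) (simp add: comb_seq_less)
  then show ?case
    by (simp add: cond_expect_def)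
next
  case (step n)
  have "\<bar>capital (Suc n) \<omega>'\<bar> \<le> 2 ^ Suc n" for \<omega>'
    using capital_le[of "Suc n" \<omega>'] capital_nonneg[of "Suc n" \<omega>'] by linarith
  then have "cond_expect m (capital (Suc n)) \<omega> = cond_expect m (cond_expect n (capital (Suc n))) \<omega>"
    using step by (intro cond_expect_tower[where B = "2 ^ Suc n", symmetric]) auto
  also have "cond_expect n (capital (Suc n)) = capital n"
    by (intro ext cond_expect_capital_Suc)
  finally show ?case using step by simp
qed

lemma computable_martingale_capital: "computable_martingale capital"
proof -
  have "\<exists>g. AE \<omega> in rows. capital n \<omega> = g (initial_rows n \<omega>)" for n
    by (rule exI[of _ "\<lambda>rs. real (pi1 (bet_state (rows_oracle rs) n))"]) (simp add: capital_rows_oracle)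
  then show ?thesis
    unfolding computable_martingale_def martingale_def
    using capital_names integrable_capital cond_expect_capital by simp
qed

lemma not_convergent_unbounded:
  fixes X :: "nat \<Rightarrow> real"
  assumes "\<And>B. \<exists>n. B \<le> X n"
  shows "\<not> convergent X"
proof
  assume "convergent X"
  then obtain K where "\<And>n. norm (X n) \<le> K"
    using convergent_imp_Bseq Bseq_def by metis
  moreover obtain n where "K + 1 \<le> X n"
    using assms by blast
  ultimately show False
    by (metis abs_le_D1 add_le_same_cancel1 not_one_le_zero order_trans real_norm_def)
qed

text \<open>The capital doubles at every \<open>r (Suc i)\<close>, and minimality excludes other
  bets. The condition \<open>e i \<le> r i\<close> is there because \<open>run_length\<close> counts
  at most \<open>x\<close> ones in row \<open>x\<close>; \<open>r 0 = 0\<close> and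
  \<open>e 0 = 0\<close> match the initial state.\<close>

lemma not_Doob_randomI:
  assumes r0: "r 0 = 0" and "e 0 = 0" and e: "\<And>i. e i \<le> r i"
    and r: "\<And>i. r (Suc i) = (LEAST n. r i < n \<and> halting_certificate (e i) (r i) n)"
    and halts: "\<And>i. \<exists>n>r i. halting_certificate (e i) (r i) n"
    and win: "\<And>i. \<omega> (r (Suc i)) 0"
    and run: "\<And>i l. l < e (Suc i) \<Longrightarrow> \<omega> (r (Suc i)) (Suc l)"
    and stop: "\<And>i. \<not> \<omega> (r (Suc i)) (Suc (e (Suc i)))"
  shows "\<not> Doob_random \<omega>"
proof -
  have step: "r i < r (Suc i) \<and> halting_certificate (e i) (r i) (r (Suc i))" for i
    unfolding r[of i] using halts[of i] by (rule LeastI_ex)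
  have least: "\<not> halting_certificate (e i) (r i) n" if "r i < n" "n < r (Suc i)" for i n
    using that not_less_Least[of n "\<lambda>n. r i < n \<and> halting_certificate (e i) (r i) n"] r by auto
  have run_length: "run_length (entries \<omega>) (r i) = e i" for i
  proof (cases i)
    case 0
    then show ?thesis using r0 \<open>e 0 = 0\<close> by (simp add: run_length_def)
  next
    case (Suc i')
    have "(\<forall>l<Suc j. \<omega> (r i) (Suc l)) \<longleftrightarrow> j < e i" for j
      using run[of _ i'] stop[of i'] Suc by (metis less_Suc_eq less_trans not_less_eq)
    then have "run_length (entries \<omega>) (r i) = (\<Sum>j<r i. of_bool (j < e i))"
      by (simp add: run_length_def)
    also have "\<dots> = card {j. j < r i \<and> j < e i}"
      by (simp add: of_bool_def sum.If_cases Int_def)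
    also have "{j. j < r i \<and> j < e i} = {..<e i}"
      using e[of i] by auto
    finally show ?thesis by simp
  qed
  \<comment> \<open>A phase starts just after the row of its last bet, except that phase 0 starts at
    row 0 itself; no bet is placed there because 0 is not a certificate.\<close>
  have state: "bet_state (entries \<omega>) n = prod_encode (2 ^ i, r i)"
    if "r i < n \<or> i = 0" "n \<le> r (Suc i)" "bet_state (entries \<omega>) (if i = 0 then 0 else Suc (r i)) = prod_encode (2 ^ i, r i)" for i n
  proof -
    define n0 where "n0 = (if i = 0 then 0 else Suc (r i))"
    have "n0 \<le> n" using that by (auto simp: n0_def)
    then show ?thesis
      using that(2)
    proof (induction n rule: dec_induct)
      case base
      show ?case using that(3) by (simp add: n0_def)
    next
      case (step k)
      then have "\<not> halting_certificate (e i) (r i) k"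
        using least[of i k] r0 by (cases "k = 0") (auto simp: n0_def split: if_splits)
      with step show ?case
        by (simp add: bet_step_def run_length)
    qed
  qed
  have win_state: "bet_state (entries \<omega>) (if i = 0 then 0 else Suc (r i)) = prod_encode (2 ^ i, r i)" for i
  proof (induction i)
    case (Suc i)
    have "bet_state (entries \<omega>) (r (Suc i)) = prod_encode (2 ^ i, r i)"
      using step[of i] by (intro state[OF _ order.refl Suc.IH]) blast
    then show ?case
      using step[of i] win[of i] by (simp add: bet_step_def run_length)
  qed (simp add: r0)
  have cap: "capital (if i = 0 then 0 else Suc (r i)) \<omega> = 2 ^ i" for i
    by (simp only: capital_def win_state) simp
  have "\<exists>n. B \<le> capital n \<omega>" for B
  proof -
    obtain i where "B < 2 ^ i"
      using real_arch_pow[of 2 B] by auto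
    then show ?thesis
      using cap[of i] by (metis less_imp_le)
  qed
  then have "\<not> convergent (\<lambda>n. capital n \<omega>)"
    by (rule not_convergent_unbounded)
  then show ?thesis
    unfolding Doob_random_def using computable_martingale_capital capital_nonneg by blast
qed


section \<open>Schnorr randomness along sparse winning bets\<close>

lemma agree_split: "p \<notin> F \<Longrightarrow> agree F a = agree (insert p F) (a(p := False)) \<union> agree (insert p F) (a(p := True))"
  by (auto simp: agree_def)

text \<open>
  Deciding bits one by one, an additive set function can be kept below the same multiple of the measure.
\<close>

lemma extend_below:
  fixes N :: nat
  assumes F: "finite F" and W: "W \<in> sets cantor" and D: "D \<in> sets cantor"
    and le: "measure cantor (agree F a \<inter> W) + l * measure cantor (agree F a \<inter> D) \<le> c * measure cantor (agree F a)"
  shows "\<exists>a'. (\<forall>p\<in>F. a' p = a p) \<and>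
    measure cantor (agree (F \<union> {..<N}) a' \<inter> W) + l * measure cantor (agree (F \<union> {..<N}) a' \<inter> D)
      \<le> c * measure cantor (agree (F \<union> {..<N}) a')"
proof (induction N)
  case 0
  show ?case using le by auto
next
  case (Suc N)
  then obtain a' where a': "\<forall>p\<in>F. a' p = a p"
    "measure cantor (agree (F \<union> {..<N}) a' \<inter> W) + l * measure cantor (agree (F \<union> {..<N}) a' \<inter> D)
      \<le> c * measure cantor (agree (F \<union> {..<N}) a')"
    by blast
  let ?F = "F \<union> {..<N}"
  have insert: "F \<union> {..<Suc N} = insert N ?F"
    by auto
  show ?case
  proof (cases "N \<in> ?F")
    case True
    then show ?thesis using a' unfolding insert by (metis insert_absorb)
  next
    case False
    define \<phi> where "\<phi> b S = measure cantor (agree (insert N ?F) (a'(N := b)) \<inter> S)" for b S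
    have split: "measure cantor (agree ?F a' \<inter> S) = \<phi> False S + \<phi> True S" if "S \<in> sets cantor" for S
    proof -
      have "agree ?F a' \<inter> S = (agree (insert N ?F) (a'(N := False)) \<inter> S) \<union> (agree (insert N ?F) (a'(N := True)) \<inter> S)"
        by (subst agree_split[OF False]) blast
      moreover have "agree (insert N ?F) (a'(N := False)) \<inter> agree (insert N ?F) (a'(N := True)) = {}"
        by (auto simp: agree_def)
      ultimately show ?thesis
        unfolding \<phi>_def using that by (simp only:) (intro cantor.finite_measure_Union, auto)
    qed
    have "(\<phi> False W + l * \<phi> False D) + (\<phi> True W + l * \<phi> True D) \<le> c * \<phi> False UNIV + c * \<phi> True UNIV"
      using a'(2) split[OF W] split[OF D] split[of UNIV] sets.top[of cantor]
      by (simp add: algebra_simps)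
    then have "\<phi> False W + l * \<phi> False D \<le> c * \<phi> False UNIV \<or> \<phi> True W + l * \<phi> True D \<le> c * \<phi> True UNIV"
      by linarith
    then obtain b where "\<phi> b W + l * \<phi> b D \<le> c * \<phi> b UNIV"
      by blast
    moreover have "\<forall>p\<in>F. (a'(N := b)) p = a p"
      using a'(1) False by auto
    ultimately show ?thesis
      unfolding insert \<phi>_def Int_UNIV_right by blast
  qed
qed

lemma prod_encode_less_Suc: "prod_encode (a, b) < prod_encode (a, Suc b)"
proof (rule le_neq_implies_less)
  show "prod_encode (a, b) \<le> prod_encode (a, Suc b)"
    by (rule prod_encode_mono) auto
qed simp

text \<open>A code in row \<open>r l\<close> with \<open>l \<le> i\<close> ends at entry
  \<open>Suc (e l)\<close>, which is at most \<open>Suc (r i)\<close>, so by monotonicity of pairing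
  all bits fixed up to stage \<open>i\<close> lie below \<open>row_bound (r i)\<close>.\<close>

abbreviation row_bound :: "nat \<Rightarrow> nat" where
  "row_bound n \<equiv> prod_encode (n, Suc (Suc n))"

text \<open>The summand \<open>row_bound n\<close> compensates for the measure of the current
  condition, \<open>2 * n\<close> for the number of tests and the length of the next code, and 7 for
  the constants, leaving 1/8.\<close>

abbreviation precision :: "nat \<Rightarrow> nat" where
  "precision n \<equiv> row_bound n + 2 * n + 7"

text \<open>
  \<open>r i\<close> is the row of the \<open>i\<close>-th bet, \<open>e i\<close> the program coded there, and \<open>V j\<close> the open set
  to be avoided from stage \<open>i\<close> on if \<open>j < g i\<close>.  Its part \<open>W j s\<close> is determined by the first \<open>s\<close> bits;
  the rows \<open>r i\<close> grow fast enough for the rest of \<open>V j\<close> to be negligible when a bet has to be won.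
\<close>

locale sparse_bets =
  fixes r e g :: "nat \<Rightarrow> nat" and V :: "nat \<Rightarrow> (nat \<Rightarrow> bool) set" and W :: "nat \<Rightarrow> nat \<Rightarrow> (nat \<Rightarrow> bool) set"
  assumes r_mono: "strict_mono r"
    and e_le: "e i \<le> i" and g_le: "g i \<le> i" and g_mono: "mono g"
    and W_determined: "determined_below s (W j s)"
    and V_W: "V j = (\<Union>s. W j s)"
    and modulus: "j < g i \<Longrightarrow> measure cantor (V j) - measure cantor (W j (r (Suc i))) \<le> (1 / 2) ^ precision (r i)"
    and small: "g i \<le> j \<Longrightarrow> j < g (Suc i) \<Longrightarrow> measure cantor (V j) \<le> (1 / 2) ^ (row_bound (r (Suc i)) + i + 4)"
begin

text \<open>Entry 0 is the bit to be won; it is followed by \<open>e i\<close> ones and the zero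
  that ends the run.\<close>

definition code :: "nat \<Rightarrow> nat set" where
  "code i = (\<lambda>t. prod_encode (r i, t)) ` {..Suc (e i)}"

definition code_value :: "nat \<Rightarrow> bool" where
  "code_value p \<longleftrightarrow> (\<exists>i. pi1 p = r i \<and> pi2 p \<le> e i)"

definition fixed :: "nat \<Rightarrow> nat set" where
  "fixed i = {..<r i} \<union> (\<Union>l\<in>{1..i}. code l)"

definition active :: "nat \<Rightarrow> (nat \<Rightarrow> bool) set" where
  "active i = (\<Union>j<g i. V j)"

definition good :: "nat \<Rightarrow> (nat \<Rightarrow> bool) \<Rightarrow> bool" where
  "good i a \<longleftrightarrow> (\<forall>l\<in>{1..i}. \<forall>p\<in>code l. a p = code_value p) \<and>
     measure cantor (agree (fixed i) a \<inter> active i) \<le> measure cantor (agree (fixed i) a) / 4"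

lemma index_le_row: "i \<le> r i"
  using r_mono by (rule strict_mono_imp_increasing)

lemma W_sets: "W j s \<in> sets cantor"
  using W_determined by (rule determined_below_measurable)

lemma V_sets: "V j \<in> sets cantor"
  unfolding V_W using W_sets by auto

lemma active_sets: "active i \<in> sets cantor"
  unfolding active_def using V_sets by auto

lemma finite_code: "finite (code i)"
  by (simp add: code_def)

lemma finite_fixed: "finite (fixed i)"
  by (simp add: fixed_def finite_code)

lemma card_code: "card (code i) = e i + 2"
  unfolding code_def by (subst card_image) (auto simp: inj_on_def)

lemma fixed_Suc: "fixed (Suc i) = (fixed i \<union> {..<r (Suc i)}) \<union> code (Suc i)"
proof -
  have "{..<r i} \<subseteq> {..<r (Suc i)}"
    using r_mono by (simp add: strict_mono_Suc_iff less_imp_le)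
  moreover have "{1..Suc i} = insert (Suc i) {1..i}"
    by auto
  ultimately show ?thesis
    unfolding fixed_def by auto
qed

lemma code_fresh: "code (Suc i) \<inter> (fixed i \<union> {..<r (Suc i)}) = {}"
proof -
  have "r l \<noteq> r (Suc i)" if "l \<le> i" for l
    using r_mono that by (metis Suc_n_not_le_n strict_mono_eq)
  moreover have "r i \<le> r (Suc i)"
    using r_mono by (simp add: strict_mono_Suc_iff less_imp_le)
  moreover have "r (Suc i) \<le> prod_encode (r (Suc i), t)" for t
    by (rule le_prod_encode_1)
  ultimately show ?thesis
    unfolding code_def fixed_def by (force simp: not_less[symmetric] dest: less_le_trans)
qed

lemma fixed_bound: "fixed i \<subseteq> {..<row_bound (r i)}"
proof
  fix p assume "p \<in> fixed i"
  then consider "p < r i" | l t where "l \<le> i" "t \<le> Suc (e l)" "p = prod_encode (r l, t)"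
    unfolding fixed_def code_def by auto
  then show "p \<in> {..<row_bound (r i)}"
  proof cases
    case 1
    then show ?thesis using le_prod_encode_1[of "r i" "Suc (Suc (r i))"] by simp
  next
    case (2 l t)
    have "r l \<le> r i"
      using r_mono 2(1) by (simp add: strict_mono_less_eq)
    moreover have "t \<le> Suc (r i)"
      using 2 e_le[of l] index_le_row[of i] by linarith
    ultimately have "p \<le> prod_encode (r i, Suc (r i))"
      unfolding 2(3) by (rule prod_encode_mono)
    then show ?thesis
      using prod_encode_less_Suc[of "r i" "Suc (r i)"] by simp
  qed
qed

lemma measure_fixed_ge: "(1 / 2) ^ row_bound (r i) \<le> measure cantor (agree (fixed i) a)"
proof -
  have "card (fixed i) \<le> row_bound (r i)"
    using card_mono[OF _ fixed_bound[of i]] by simp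
  then show ?thesis
    unfolding measure_agree[OF finite_fixed] by (intro power_decreasing) auto
qed

lemma measure_active_tail:
  "measure cantor (active i - (\<Union>j<g i. W j (r (Suc i)))) \<le> real i * (1 / 2) ^ precision (r i)"
proof -
  let ?s = "r (Suc i)"
  have "measure cantor (active i - (\<Union>j<g i. W j ?s)) \<le> measure cantor (\<Union>j<g i. V j - W j ?s)"
    unfolding active_def using V_sets W_sets by (intro cantor.finite_measure_mono) auto
  also have "\<dots> \<le> (\<Sum>j<g i. measure cantor (V j - W j ?s))"
    using V_sets W_sets by (intro cantor.finite_measure_subadditive_finite) auto
  also have "\<dots> \<le> (\<Sum>j<g i. (1 / 2) ^ precision (r i))"
  proof (intro sum_mono)
    fix j assume "j \<in> {..<g i}"
    then show "measure cantor (V j - W j ?s) \<le> (1 / 2) ^ precision (r i)"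
      using modulus[of j i] V_sets W_sets by (subst cantor.finite_measure_Diff) (auto simp: V_W[of j])
  qed
  also have "\<dots> \<le> real i * (1 / 2) ^ precision (r i)"
    using g_le[of i] by (simp add: mult_right_mono)
  finally show ?thesis .
qed

text \<open>At most \<open>Suc i \<le> 2 ^ Suc i\<close> tests join; the summand
  \<open>i + 4\<close> in \<open>small\<close> pays for their number and leaves one eighth of a
  lower bound for the measure of the next condition.\<close>

lemma measure_active_Suc:
  assumes "S \<in> sets cantor"
  shows "measure cantor (S \<inter> active (Suc i)) \<le> measure cantor (S \<inter> active i) + (1 / 2) ^ row_bound (r (Suc i)) / 8"
proof -
  let ?N = "\<Union>j\<in>{g i..<g (Suc i)}. V j"
  have "S \<inter> active (Suc i) \<subseteq> (S \<inter> active i) \<union> ?N"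
  proof
    fix x assume "x \<in> S \<inter> active (Suc i)"
    then obtain j where "x \<in> S" "j < g (Suc i)" "x \<in> V j"
      by (auto simp: active_def)
    then show "x \<in> (S \<inter> active i) \<union> ?N"
      by (cases "j < g i") (auto simp: active_def)
  qed
  then have "measure cantor (S \<inter> active (Suc i)) \<le> measure cantor ((S \<inter> active i) \<union> ?N)"
    using assms active_sets V_sets by (intro cantor.finite_measure_mono) auto
  also have "\<dots> \<le> measure cantor (S \<inter> active i) + measure cantor ?N"
    using assms active_sets V_sets by (intro measure_Un_le) auto
  also have "measure cantor ?N \<le> (\<Sum>j\<in>{g i..<g (Suc i)}. measure cantor (V j))"
    using V_sets by (intro cantor.finite_measure_subadditive_finite) auto
  also have "\<dots> \<le> (\<Sum>j\<in>{g i..<g (Suc i)}. (1 / 2) ^ (row_bound (r (Suc i)) + i + 4))"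
    using small by (intro sum_mono) auto
  also have "\<dots> \<le> 2 ^ Suc i * (1 / 2) ^ (row_bound (r (Suc i)) + i + 4)"
  proof -
    have "g (Suc i) - g i \<le> 2 ^ Suc i"
      using g_le[of "Suc i"] less_exp[of "Suc i"] by linarith
    then have "real (g (Suc i) - g i) \<le> 2 ^ Suc i"
      by (metis of_nat_le_iff of_nat_numeral of_nat_power)
    then show ?thesis
      by (simp add: mult_right_mono del: power_Suc)
  qed
  also have "\<dots> = (1 / 2) ^ row_bound (r (Suc i)) / 8"
    by (simp add: power_add power_one_over field_simps)
  finally show ?thesis by simp
qed

text \<open>The bits below the next betting row are chosen to leave the visible part
  \<open>w\<close> altogether and to keep the tail \<open>D\<close> tiny; only then are the code
  bits forced. Forcing raises the relative measure of the tail by at most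
  \<open>2^(e (Suc i) + 2)\<close>, which its smallness absorbs. One eighth for the old tests and
  one eighth for the new ones restore the quarter.\<close>

lemma good_extend:
  assumes "good i a"
  shows "\<exists>a'. good (Suc i) a' \<and> (\<forall>p\<in>fixed i. a' p = a p)"
proof -
  define N where "N = r (Suc i)"
  define w where "w = (\<Union>j<g i. W j N)"
  define D where "D = active i - w"
  define K where "K = agree (fixed i) a"
  \<comment> \<open>\<open>Suc i\<close> instead of \<open>i\<close> keeps \<open>\<eta>\<close>
    positive at stage 0, as the division below requires.\<close>
  define \<eta> where "\<eta> = real (Suc i) * (1 / 2) ^ precision (r i)"
  \<comment> \<open>With this weight \<open>D\<close> counts for at most a quarter of
    \<open>K\<close>, as \<open>w\<close> does; the resulting ratio 1/2 is below 1, which the next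
    choice exploits.\<close>
  define l where "l = measure cantor K / (4 * \<eta>)"
  have w: "determined_below N w"
    unfolding w_def using W_determined by (intro determined_below_UN)
  have w_sets: "w \<in> sets cantor" and D_sets: "D \<in> sets cantor"
    unfolding D_def using determined_below_measurable[OF w] active_sets by auto
  have \<eta>: "\<eta> > 0"
    by (simp add: \<eta>_def)
  have K_pos: "measure cantor K > 0"
    unfolding K_def by (simp add: measure_agree finite_fixed)
  have l: "l > 0"
    unfolding l_def using \<eta> K_pos by simp
  have "measure cantor (K \<inter> w) \<le> measure cantor K / 4"
  proof -
    have "measure cantor (K \<inter> w) \<le> measure cantor (K \<inter> active i)"
      unfolding K_def w_def active_def V_W using W_sets
      by (intro cantor.finite_measure_mono) auto
    also have "\<dots> \<le> measure cantor K / 4"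
      using assms unfolding good_def K_def by blast
    finally show ?thesis .
  qed
  moreover have "l * measure cantor (K \<inter> D) \<le> measure cantor K / 4"
  proof -
    have "measure cantor (K \<inter> D) \<le> measure cantor D"
      using D_sets by (intro cantor.finite_measure_mono) auto
    also have "\<dots> \<le> real i * (1 / 2) ^ precision (r i)"
      unfolding D_def w_def N_def by (rule measure_active_tail)
    also have "\<dots> \<le> \<eta>"
      unfolding \<eta>_def by (intro mult_right_mono) auto
    finally have "l * measure cantor (K \<inter> D) \<le> l * \<eta>"
      using l by simp
    also have "\<dots> = measure cantor K / 4"
      unfolding l_def using \<eta> by simp
    finally show ?thesis .
  qed
  ultimately have "measure cantor (K \<inter> w) + l * measure cantor (K \<inter> D) \<le> 1 / 2 * measure cantor K"
    by linarith
  from extend_below[OF finite_fixed w_sets D_sets this[unfolded K_def], of N]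
  obtain a1 where a1: "\<forall>p\<in>fixed i. a1 p = a p"
    "measure cantor (agree (fixed i \<union> {..<N}) a1 \<inter> w) + l * measure cantor (agree (fixed i \<union> {..<N}) a1 \<inter> D)
      \<le> 1 / 2 * measure cantor (agree (fixed i \<union> {..<N}) a1)"
    by blast
  define F where "F = fixed i \<union> {..<N}"
  define K' where "K' = agree F a1"
  have F: "finite F"
    by (simp add: F_def finite_fixed)
  have K'_pos: "measure cantor K' > 0"
    unfolding K'_def by (simp add: measure_agree F)
  note a1' = a1(2)[folded F_def, folded K'_def]
  \<comment> \<open>All bits below \<open>N\<close> are decided, so \<open>w\<close> either contains
    \<open>K'\<close> or misses it, and the ratio 1/2 rules out the former.\<close>
  have "K' \<inter> w = {}"
  proof (rule ccontr)
    assume "K' \<inter> w \<noteq> {}"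
    then obtain x where x: "x \<in> K'" "x \<in> w" by blast
    have "y \<in> w" if "y \<in> K'" for y
      using determined_belowD[OF w, of x y] x that by (auto simp: K'_def agree_def F_def)
    then have "K' \<inter> w = K'" by blast
    moreover have "0 \<le> l * measure cantor (K' \<inter> D)"
      using l by simp
    ultimately show False
      using a1' K'_pos by simp
  qed
  then have "K' \<inter> active i = K' \<inter> D"
    unfolding D_def by blast
  moreover have "l * measure cantor (K' \<inter> D) \<le> measure cantor K' / 2"
    using a1' measure_nonneg[of cantor "K' \<inter> w"] by linarith
  ultimately have "measure cantor (K' \<inter> active i) \<le> measure cantor K' / (2 * l)"
    using l by (simp add: field_simps)
  also have "\<dots> = 2 * \<eta> / measure cantor K * measure cantor K'"
    unfolding l_def using \<eta> K_pos by (simp add: field_simps)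
  also have "\<dots> \<le> 2 * \<eta> * 2 ^ row_bound (r i) * measure cantor K'"
  proof -
    have "1 / measure cantor K \<le> 1 / (1 / 2) ^ row_bound (r i)"
      unfolding K_def by (intro divide_left_mono measure_fixed_ge) (simp_all add: measure_agree finite_fixed)
    also have "\<dots> = 2 ^ row_bound (r i)"
      by (simp add: power_one_over)
    finally have "2 * \<eta> * measure cantor K' * (1 / measure cantor K) \<le> 2 * \<eta> * measure cantor K' * 2 ^ row_bound (r i)"
      using \<eta> by (intro mult_left_mono) auto
    then show ?thesis by (simp add: mult_ac)
  qed
  finally have K'_active: "measure cantor (K' \<inter> active i) \<le> 2 * \<eta> * 2 ^ row_bound (r i) * measure cantor K'" .
  define a' where "a' p = (if p \<in> code (Suc i) then code_value p else a1 p)" for p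
  define K'' where "K'' = agree (fixed (Suc i)) a'"
  have fresh: "code (Suc i) \<inter> F = {}"
    unfolding F_def N_def by (rule code_fresh)
  have fixed': "fixed (Suc i) = F \<union> code (Suc i)"
    unfolding F_def N_def by (rule fixed_Suc)
  have "K'' \<subseteq> K'"
    using fresh unfolding K''_def K'_def fixed' agree_def a'_def by auto
  have "card (fixed (Suc i)) = card F + (e (Suc i) + 2)"
    unfolding fixed' using fresh by (subst card_Un_disjoint) (auto simp: F finite_code card_code)
  then have K'': "measure cantor K' = 2 ^ (e (Suc i) + 2) * measure cantor K''"
    unfolding K'_def K''_def measure_agree[OF F] measure_agree[OF finite_fixed]
    by (simp add: power_add power_one_over)
  have "measure cantor (K'' \<inter> active i) \<le> measure cantor (K' \<inter> active i)"
    using \<open>K'' \<subseteq> K'\<close> active_sets unfolding K'_def by (intro cantor.finite_measure_mono) auto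
  also have "\<dots> \<le> (2 * \<eta> * 2 ^ row_bound (r i) * 2 ^ (e (Suc i) + 2)) * measure cantor K''"
    using K'_active unfolding K'' by (simp add: mult_ac)
  \<comment> \<open>The power of \<open>row_bound (r i)\<close> cancels against
    \<open>\<eta>\<close>. What remains is at most \<open>2^(2 * i + 4)\<close>, and
    \<open>i \<le> r i\<close> lets the rest of the precision outweigh it.\<close>
  also have "\<dots> \<le> 1 / 8 * measure cantor K''"
  proof (intro mult_right_mono measure_nonneg)
    have "2 * \<eta> * 2 ^ row_bound (r i) * 2 ^ (e (Suc i) + 2) = real (Suc i) * 2 ^ (e (Suc i) + 3) / 2 ^ (2 * r i + 7)"
      unfolding \<eta>_def by (simp add: power_add power_one_over field_simps)
    also have "\<dots> \<le> 2 ^ i * 2 ^ (i + 4) / 2 ^ (2 * r i + 7)"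
    proof (intro divide_right_mono mult_mono)
      have "Suc i \<le> 2 ^ i"
        using less_exp[of i] by linarith
      then show "real (Suc i) \<le> 2 ^ i"
        by (metis of_nat_le_iff of_nat_numeral of_nat_power)
      show "(2::real) ^ (e (Suc i) + 3) \<le> 2 ^ (i + 4)"
        using e_le[of "Suc i"] by (intro power_increasing) auto
    qed auto
    also have "\<dots> = 2 ^ (2 * i + 4) / 2 ^ (2 * r i + 7)"
      using power_add[of "2::real" i "i + 4"] by (simp only: mult_2 add.assoc)
    also have "\<dots> \<le> 2 ^ (2 * r i + 4) / 2 ^ (2 * r i + 7)"
      using index_le_row[of i] by (intro divide_right_mono power_increasing) auto
    also have "\<dots> = 1 / 8"
      by (simp add: power_add)
    finally show "2 * \<eta> * 2 ^ row_bound (r i) * 2 ^ (e (Suc i) + 2) \<le> 1 / 8" .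
  qed
  finally have "measure cantor (K'' \<inter> active (Suc i)) \<le> measure cantor K'' / 4"
    using measure_active_Suc[of K'' i] measure_fixed_ge[of "Suc i" a'] unfolding K''_def by auto
  moreover have "a' p = code_value p" if "l \<in> {1..Suc i}" "p \<in> code l" for l p
  proof (cases "l = Suc i")
    case True
    then show ?thesis using that by (simp add: a'_def)
  next
    case False
    then have l: "l \<in> {1..i}" using that by auto
    then have "p \<in> fixed i"
      using that unfolding fixed_def by blast
    then have "a' p = a p"
      using fresh a1(1) by (auto simp: a'_def F_def)
    also have "\<dots> = code_value p"
      using assms l that unfolding good_def by blast
    finally show ?thesis .
  qed
  moreover have "\<forall>p\<in>fixed i. a' p = a p"
    using fresh a1(1) by (auto simp: a'_def F_def)
  ultimately show ?thesis
    unfolding good_def K''_def by blast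
qed

lemma fixed_mono: "i \<le> i' \<Longrightarrow> fixed i \<subseteq> fixed i'"
  by (induction rule: dec_induct) (auto simp: fixed_Suc)

lemma avoiding_sequence:
  assumes "g 0 = 0"
  obtains a where "\<And>i t. t \<le> e (Suc i) \<Longrightarrow> a (prod_encode (r (Suc i), t))"
    and "\<And>i. \<not> a (prod_encode (r (Suc i), Suc (e (Suc i))))"
    and "\<And>i j. j < g i \<Longrightarrow> a \<notin> V j"
proof -
  have "good 0 (\<lambda>_. False)"
    using assms by (simp add: good_def active_def)
  then obtain f where good: "\<And>i. good i (f i)" and f: "\<And>i. \<forall>p\<in>fixed i. f (Suc i) p = f i p"
    using dependent_nat_choice[of good "\<lambda>i a a'. \<forall>p\<in>fixed i. a' p = a p"] good_extend by metis
  have stable: "f i' p = f i p" if "i \<le> i'" "p \<in> fixed i" for i i' p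
    using that
  proof (induction rule: dec_induct)
    case (step k)
    then have "p \<in> fixed k"
      using fixed_mono[of i k] by blast
    then show ?case
      using f[of k] step by auto
  qed simp
  define a where "a p = f (Suc p) p" for p
  have a: "a p = f i p" if "p \<in> fixed i" for p i
  proof -
    have "p \<in> fixed (Suc p)"
      using index_le_row[of "Suc p"] by (simp add: fixed_def)
    then show ?thesis
      using that stable[of "Suc p" i p] stable[of i "Suc p" p] unfolding a_def by (metis nat_le_linear)
  qed
  have code: "a p = code_value p" if "p \<in> code (Suc i)" for i p
  proof -
    have "p \<in> fixed (Suc i)"
      using that by (auto simp: fixed_def)
    then show ?thesis
      using a good[of "Suc i"] that unfolding good_def by auto
  qed
  have "a (prod_encode (r (Suc i), t))" if "t \<le> e (Suc i)" for i t
    using that by (subst code[of _ i]) (auto simp: code_def code_value_def)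
  moreover have "\<not> a (prod_encode (r (Suc i), Suc (e (Suc i))))" for i
    using r_mono by (subst code[of _ i]) (auto simp: code_def code_value_def strict_mono_eq)
  moreover have "a \<notin> V j" if "j < g i" for i j
  proof
    assume "a \<in> V j"
    then obtain s where s: "a \<in> W j s"
      by (auto simp: V_W)
    \<comment> \<open>At stage \<open>m\<close> the first \<open>s\<close> bits are fixed and test
      \<open>j\<close> is active. The whole condition would lie in \<open>V j\<close>, against the
      bound of a quarter.\<close>
    define m where "m = max i s"
    have "agree (fixed m) (f m) \<subseteq> W j s"
    proof
      fix x assume x: "x \<in> agree (fixed m) (f m)"
      have "x p = a p" if "p < s" for p
      proof -
        have "p \<in> fixed m"
          using that index_le_row[of m] by (auto simp: fixed_def m_def)
        then show ?thesis using x a by (auto simp: agree_def)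
      qed
      then show "x \<in> W j s"
        using determined_belowD[OF W_determined, of s x a j] s by blast
    qed
    moreover have "j < g m"
      using that monoD[OF g_mono, of i m] by (simp add: m_def)
    ultimately have "agree (fixed m) (f m) \<inter> active m = agree (fixed m) (f m)"
      unfolding active_def by (auto simp: V_W)
    then show False
      using good[of m] by (simp add: good_def measure_agree finite_fixed)
  qed
  ultimately show thesis
    by (rule that)
qed

end

section \<open>A Schnorr random that is not Doob random\<close>

lemma countable_recfun: "countable (UNIV :: recfun set)"
proof (rule countableI)
  have "encode_recfun p = encode_recfun q \<Longrightarrow> p = q" for p q
  proof (induction p arbitrary: q)
    case (Tuple p1 p2)
    then show ?case by (cases q) auto
  next
    case (Compose p1 p2)
    then show ?case by (cases q) auto
  next
    case (PrimRec p1 p2)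
    then show ?case by (cases q) auto
  next
    case (Mu p)
    then show ?case by (cases q) auto
  qed (case_tac q; simp)+
  then show "inj encode_recfun"
    by (auto intro: injI)
qed

lemma countable_Schnorr_tests: "countable {U. Schnorr_test U}"
proof (rule countable_subset)
  define F where "F p k = (\<Union>\<sigma> \<in> {\<sigma>. \<exists>y. computes no_oracle p
        (prod_encode (k, list_encode (map of_bool \<sigma>))) y}. cylinder \<sigma>)" for p k
  show "{U. Schnorr_test U} \<subseteq> range F"
  proof
    fix U assume "U \<in> {U. Schnorr_test U}"
    then obtain p where "\<forall>k. U k = F p k"
      unfolding Schnorr_test_def effectively_open_seq_def F_def by blast
    then have "U = F p" by (intro ext) simp
    then show "U \<in> range F" by simp
  qed
  show "countable (range F)"
    using countable_recfun by (rule countable_image)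
qed

text \<open>A program with a large code is postponed until the number of the bet has caught up, so
  codes stay affordable; \<open>E 0 = 0\<close> ensures that some choice is admissible at every
  stage.\<close>

lemma slow_enumeration:
  fixes E :: "nat \<Rightarrow> nat"
  assumes "E 0 = 0"
  shows "\<exists>g. mono g \<and> (\<forall>i. g i \<le> i) \<and> (\<forall>i. E (g i) \<le> i) \<and> (\<forall>j. \<exists>i. j < g i)"
proof -
  define S where "S i = {m. m \<le> i \<and> E m \<le> i}" for i
  define g where "g i = Max (S i)" for i
  have S: "finite (S i)" "S i \<noteq> {}" for i
    unfolding S_def using assms by auto
  have g: "g i \<le> i \<and> E (g i) \<le> i" for i
    using Max_in[OF S, of i] unfolding g_def S_def by simp
  moreover have "mono g"
  proof (rule monoI)
    fix i i' :: nat assume "i \<le> i'"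
    then have "S i \<subseteq> S i'" by (auto simp: S_def)
    then show "g i \<le> g i'"
      unfolding g_def using S by (intro Max_mono)
  qed
  moreover have "j < g (max (Suc j) (E (Suc j)))" for j
  proof -
    have "Suc j \<le> g (max (Suc j) (E (Suc j)))"
      unfolding g_def by (rule Max_ge[OF S(1)]) (simp add: S_def)
    then show ?thesis by simp
  qed
  ultimately show ?thesis
    by blast
qed

lemma Schnorr_not_Doob: "\<exists>\<omega>. Schnorr_random \<omega> \<and> \<not> Doob_random \<omega>"
proof -
  define U where "U = from_nat_into {U. Schnorr_test U}"
  have U_test: "Schnorr_test (U j)" for j
    using from_nat_into[of "{U. Schnorr_test U}" j] Schnorr_test_ones_test unfolding U_def by blast
  have U_surj: "\<exists>j. T = U j" if "Schnorr_test T" for T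
    using from_nat_into_surj[OF countable_Schnorr_tests, of T] that unfolding U_def by auto
  obtain h W where h: "\<And>j. computable_over {no_oracle} (\<lambda>A. h j)"
    and W: "\<And>j k s. determined_below s (W j k s)" "\<And>j k. U j k = (\<Union>s. W j k s)"
    and modulus: "\<And>j k x s. k \<le> x \<Longrightarrow> h j x \<le> s \<Longrightarrow>
       measure cantor (U j k) - measure cantor (W j k s) \<le> (1 / 2) ^ x"
    using Schnorr_test_modulus[OF U_test] by metis
  \<comment> \<open>For fixed \<open>m\<close> only finitely many moduli occur, so each sum is
    computable even if the family \<open>h\<close> is not uniformly so.\<close>
  have "\<exists>p. \<forall>x. computes no_oracle p x (\<Sum>j<m. h j (precision x))" for m
  proof -
    have "computable_over {no_oracle} (\<lambda>A x. \<Sum>j<m. h j (precision x))"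
    proof (induction m)
      case (Suc m)
      have "computable_over {no_oracle} (\<lambda>A x. h m (precision x))"
        by (intro computable_compose[OF h] computable_intros)
      from computable_add[OF Suc this] show ?case by simp
    qed (simp add: computable_const)
    then show ?thesis unfolding computable_over_def by blast
  qed
  then obtain P' where P': "\<And>m x. computes no_oracle (P' m) x (\<Sum>j<m. h j (precision x))"
    by metis
  \<comment> \<open>\<open>Zero\<close> has code 0 and outputs the empty sum; this matches the empty
    run from which the martingale starts.\<close>
  define P where "P m = (if m = 0 then Zero else P' m)" for m
  have P: "computes no_oracle (P m) x (\<Sum>j<m. h j (precision x))" for m x
    using P'[of m x] computes.zero by (simp add: P_def)
  define E where "E m = encode_recfun (P m)" for m
  have "E 0 = 0"
    by (simp add: E_def P_def prod_encode_def)
  then obtain g where g: "mono g" "\<And>i. g i \<le> i" "\<And>i. E (g i) \<le> i" "\<And>j. \<exists>i. j < g i"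
    using slow_enumeration by metis
  define e where "e i = E (g i)" for i
  define r where "r = rec_nat 0 (\<lambda>i x. LEAST n. x < n \<and> halting_certificate (e i) x n)"
  have r0: "r 0 = 0" and r: "\<And>i. r (Suc i) = (LEAST n. r i < n \<and> halting_certificate (e i) (r i) n)"
    by (simp_all add: r_def)
  have halts: "\<exists>n>r i. halting_certificate (e i) (r i) n" for i
    unfolding e_def E_def by (rule halting_certificate_complete[OF P])
  then have step: "r i < r (Suc i) \<and> halting_certificate (e i) (r i) (r (Suc i))" for i
    unfolding r[of i] by (rule LeastI_ex)
  then have r_mono: "strict_mono r"
    by (simp add: strict_mono_Suc_iff)
  have h_le: "h j (precision (r i)) \<le> r (Suc i)" if "j < g i" for i j
  proof -
    obtain y where "y < r (Suc i)" "computes no_oracle (P (g i)) (r i) y"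
      using step[of i] halting_certificate_sound unfolding e_def E_def by blast
    then have "(\<Sum>j<g i. h j (precision (r i))) \<le> r (Suc i)"
      using computes_deterministic[OF P, of "g i" "r i"] by auto
    moreover have "h j (precision (r i)) \<le> (\<Sum>j<g i. h j (precision (r i)))"
      using that by (intro member_le_sum) auto
    ultimately show ?thesis by simp
  qed
  define start where "start j = (LEAST i. j < g i)" for j
  \<comment> \<open>Each test is used at a level fixed by the row at which it becomes active. This
    is not circular: \<open>r\<close> comes from the programs alone, and the moduli cover all levels
    up to the precision. For \<open>start j = Suc i\<close> the summand 3 becomes the 4 in
    \<open>small\<close>.\<close>
  define k where "k j = row_bound (r (start j)) + start j + 3" for j
  have k_le: "k j \<le> precision (r i)" if "j < g i" for i j
  proof -
    have "start j \<le> i"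
      unfolding start_def using that by (rule Least_le)
    moreover have "i \<le> r i"
      using r_mono by (rule strict_mono_imp_increasing)
    moreover have "r (start j) \<le> r i"
      using r_mono \<open>start j \<le> i\<close> by (simp add: strict_mono_less_eq)
    then have "row_bound (r (start j)) \<le> row_bound (r i)"
      by (intro prod_encode_mono) auto
    ultimately show ?thesis
      unfolding k_def by linarith
  qed
  have g0: "g 0 = 0"
    using g(2)[of 0] by simp
  interpret sparse_bets r e g "\<lambda>j. U j (k j)" "\<lambda>j. W j (k j)"
  proof
    show "measure cantor (U j (k j)) - measure cantor (W j (k j) (r (Suc i))) \<le> (1 / 2) ^ precision (r i)"
      if "j < g i" for i j
      using modulus[OF k_le[OF that] h_le[OF that]] .
    show "measure cantor (U j (k j)) \<le> (1 / 2) ^ (row_bound (r (Suc i)) + i + 4)"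
      if "g i \<le> j" "j < g (Suc i)" for i j
    proof -
      have "start j = Suc i"
        unfolding start_def
      proof (rule Least_equality)
        show "j < g (Suc i)" by fact
        fix i' assume "j < g i'"
        then show "Suc i \<le> i'"
          using that(1) monoD[OF g(1), of i' i] by (meson le_trans not_less not_less_eq_eq)
      qed
      then have "k j = row_bound (r (Suc i)) + i + 4"
        by (simp add: k_def)
      then show ?thesis
        using U_test[of j] unfolding Schnorr_test_def by metis
    qed
  qed (use r_mono g W in \<open>auto simp: e_def\<close>)
  obtain a where a: "\<And>i t. t \<le> e (Suc i) \<Longrightarrow> a (prod_encode (r (Suc i), t))"
    "\<And>i. \<not> a (prod_encode (r (Suc i), Suc (e (Suc i))))" "\<And>i j. j < g i \<Longrightarrow> a \<notin> U j (k j)"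
    using avoiding_sequence[OF g0] by blast
  define \<omega> where "\<omega> m j = a (prod_encode (m, j))" for m j
  have "join_rows \<omega> = a"
    by (auto simp: join_rows_def \<omega>_def fun_eq_iff case_prod_beta')
  then have "Schnorr_random \<omega>"
    unfolding Schnorr_random_def using U_surj a(3) g(4) by (metis INT_iff UNIV_I)
  moreover have "\<not> Doob_random \<omega>"
  proof (rule not_Doob_randomI[OF r0 _ _ r halts])
    show "e 0 = 0"
      using \<open>E 0 = 0\<close> g0 by (simp add: e_def)
    show "e i \<le> r i" for i
      using g(3)[of i] index_le_row[of i] unfolding e_def by linarith
  qed (use a in \<open>auto simp: \<omega>_def\<close>)
  ultimately show ?thesis by blast
qed


section \<open>A Doob random sequence inside a Schnorr null set\<close>

section \<open>Upcrossings\<close>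

primrec holding :: "real \<Rightarrow> real \<Rightarrow> (nat \<Rightarrow> real) \<Rightarrow> nat \<Rightarrow> bool" where
  "holding a b m 0 \<longleftrightarrow> m 0 < a"
| "holding a b m (Suc n) \<longleftrightarrow> (if holding a b m n then m (Suc n) \<le> b else m (Suc n) < a)"

text \<open>
  The wealth of an investor who always owns one share of value \<open>m n\<close>, and who with an initial cash
  of \<open>a\<close> buys a second one below \<open>a\<close> and sells it above \<open>b\<close>.
\<close>

primrec wealth :: "real \<Rightarrow> real \<Rightarrow> (nat \<Rightarrow> real) \<Rightarrow> nat \<Rightarrow> real" where
  "wealth a b m 0 = a + m 0"
| "wealth a b m (Suc n) = wealth a b m n + (if holding a b m n then 2 else 1) * (m (Suc n) - m n)"

primrec upcrossings :: "real \<Rightarrow> real \<Rightarrow> (nat \<Rightarrow> real) \<Rightarrow> nat \<Rightarrow> nat" where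
  "upcrossings a b m 0 = 0"
| "upcrossings a b m (Suc n) =
     upcrossings a b m n + of_bool (holding a b m n \<and> \<not> holding a b m (Suc n))"

lemma holding_cong: "(\<And>k. k \<le> n \<Longrightarrow> m k = m' k) \<Longrightarrow> holding a b m n = holding a b m' n"
  by (induction n) auto

lemma wealth_cong: "(\<And>k. k \<le> n \<Longrightarrow> m k = m' k) \<Longrightarrow> wealth a b m n = wealth a b m' n"
proof (induction n)
  case (Suc n)
  moreover have "holding a b m n = holding a b m' n"
    using Suc.prems by (intro holding_cong) auto
  ultimately show ?case by simp
qed simp

text \<open>A completed upcrossing turns a reserve of \<open>a\<close> into more than
  \<open>b\<close>. The share that is never sold contributes \<open>m n\<close>, so bounded wealth
  also bounds \<open>m\<close>.\<close>

lemma wealth_ge: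
  fixes m :: "nat \<Rightarrow> real" and a b :: real
  assumes "a < b"
  shows "m n + (if holding a b m n then m n else a) + upcrossings a b m n * (b - a) \<le> wealth a b m n"
proof (induction n)
  case (Suc n)
  then show ?case
    using assms by (auto simp: algebra_simps split: if_splits)
qed simp

lemma mono_upcrossings: "n \<le> k \<Longrightarrow> upcrossings a b m n \<le> upcrossings a b m k"
  by (induction rule: dec_induct) auto

lemma upcrossings_increase:
  "i \<le> k \<Longrightarrow> holding a b m i \<Longrightarrow> \<not> holding a b m k \<Longrightarrow> upcrossings a b m i < upcrossings a b m k"
proof (induction rule: dec_induct)
  case (step k)
  then show ?case
    using mono_upcrossings[where n = i and k = k and m = m and a = a and b = b] by (cases "holding a b m k") auto
qed simp

lemma upcrossings_unbounded:
  fixes m :: "nat \<Rightarrow> real" and a b :: real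
  assumes "a < b" and lo: "\<And>n. \<exists>k\<ge>n. m k < a" and hi: "\<And>n. \<exists>k\<ge>n. b < m k"
  shows "\<exists>n. K \<le> upcrossings a b m n"
proof (induction K)
  case (Suc K)
  then obtain n where n: "K \<le> upcrossings a b m n" by blast
  from lo obtain i where i: "n \<le> i" "m i < a" by blast
  from hi obtain k where k: "i \<le> k" "b < m k" by blast
  have "holding a b m i"
    using i(2) \<open>a < b\<close> by (cases i) auto
  moreover have "\<not> holding a b m k"
    using k(2) \<open>a < b\<close> by (cases k) auto
  ultimately have "upcrossings a b m i < upcrossings a b m k"
    using k(1) upcrossings_increase by blast
  moreover have "upcrossings a b m n \<le> upcrossings a b m i"
    using i(1) by (rule mono_upcrossings)
  ultimately show ?case
    using n by (intro exI[of _ k]) simp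
qed simp

text \<open>A bounded divergent sequence returns close to a cluster point \<open>l\<close> and
  strays from it infinitely often, so it keeps crossing some interval on one side of
  \<open>l\<close>. Rational endpoints suffice and keep the family of strategies countable.\<close>

lemma convergent_if_wealth_bounded:
  fixes m :: "nat \<Rightarrow> real"
  assumes nonneg: "\<And>n. 0 \<le> m n"
    and bounded: "\<And>a b. a \<in> \<rat> \<Longrightarrow> b \<in> \<rat> \<Longrightarrow> 0 \<le> a \<Longrightarrow> a < b \<Longrightarrow> \<exists>C. \<forall>n. wealth a b m n \<le> C"
  shows "convergent m"
proof (rule ccontr)
  assume not_conv: "\<not> convergent m"
  \<comment> \<open>With \<open>a = 0\<close> nothing is ever bought; this strategy serves only to
    bound \<open>m\<close>.\<close>
  obtain C where "\<And>n. wealth 0 1 m n \<le> C"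
    using bounded[of 0 1] by auto
  moreover have "m n \<le> wealth 0 1 m n" for n
    using wealth_ge[where a = 0 and b = 1 and m = m and n = n] nonneg[of n] by (auto split: if_splits)
  ultimately have "m n \<in> {0..C}" for n
    using nonneg by (auto intro: order_trans)
  then obtain l s where ls: "l \<in> {0..C}" "strict_mono s" "(m \<circ> s) \<longlonglongrightarrow> l"
    using compact_Icc[of 0 C] unfolding compact_def by metis
  from not_conv have "\<not> m \<longlonglongrightarrow> l"
    by (auto simp: convergent_def)
  then obtain \<epsilon> where \<epsilon>: "\<epsilon> > 0" "\<And>n. \<exists>k\<ge>n. \<epsilon> \<le> \<bar>m k - l\<bar>"
    unfolding lim_sequentially dist_real_def by (metis not_le)
  have close: "\<exists>k\<ge>n. \<bar>m k - l\<bar> < \<epsilon> / 3" for n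
  proof -
    obtain k0 where k0: "\<And>k. k \<ge> k0 \<Longrightarrow> \<bar>m (s k) - l\<bar> < \<epsilon> / 3"
      using ls(3) \<epsilon>(1) unfolding lim_sequentially dist_real_def comp_def
      by (metis zero_less_divide_iff zero_less_numeral)
    have "n \<le> s (max n k0)"
      using strict_mono_imp_increasing[OF ls(2), of "max n k0"] by linarith
    then show ?thesis
      using k0[of "max n k0"] by (intro exI[of _ "s (max n k0)"]) simp
  qed
  have no_crossing: False if "a \<in> \<rat>" "b \<in> \<rat>" "0 \<le> a" "a < b"
    "\<And>n. \<exists>k\<ge>n. m k < a" "\<And>n. \<exists>k\<ge>n. b < m k" for a b
  proof -
    from bounded[OF that(1-4)] obtain C where C: "\<And>n. wealth a b m n \<le> C"
      by blast
    from that(4) obtain K :: nat where K: "C < K * (b - a)"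
      using reals_Archimedean3[of "b - a"] by auto
    from upcrossings_unbounded[OF that(4-6)] obtain n where "K \<le> upcrossings a b m n"
      by blast
    then have "real K * (b - a) \<le> upcrossings a b m n * (b - a)"
      using that(4) by (intro mult_right_mono) auto
    also have "\<dots> \<le> wealth a b m n"
      using wealth_ge[OF that(4), where m = m and n = n] nonneg[of n] that(3) by (auto split: if_splits)
    finally show False
      using C[of n] K by linarith
  qed
  show False
  proof (cases "\<forall>n. \<exists>k\<ge>n. l + \<epsilon> \<le> m k")
    case True
    obtain a where a: "a \<in> \<rat>" "l + \<epsilon> / 3 < a" "a < l + \<epsilon> / 2"
      using Rats_dense_in_real[of "l + \<epsilon> / 3" "l + \<epsilon> / 2"] \<epsilon>(1) by auto
    obtain b where b: "b \<in> \<rat>" "l + \<epsilon> / 2 < b" "b < l + \<epsilon>"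
      using Rats_dense_in_real[of "l + \<epsilon> / 2" "l + \<epsilon>"] \<epsilon>(1) by auto
    show False
    proof (rule no_crossing[OF a(1) b(1)])
      show "\<exists>k\<ge>n. m k < a" for n
        using close[of n] a by (smt (verit))
      show "\<exists>k\<ge>n. b < m k" for n
        using True b by (smt (verit))
    qed (use a b ls \<epsilon> in auto)
  next
    case False
    then obtain n0 where n0: "\<And>k. n0 \<le> k \<Longrightarrow> m k < l + \<epsilon>"
      by (meson not_le)
    have low: "\<exists>k\<ge>n. m k \<le> l - \<epsilon>" for n
      using \<epsilon>(2)[of "max n n0"] n0 by (smt (verit) max.bounded_iff)
    obtain a where a: "a \<in> \<rat>" "l - \<epsilon> < a" "a < l - \<epsilon> / 2"
      using Rats_dense_in_real[of "l - \<epsilon>" "l - \<epsilon> / 2"] \<epsilon>(1) by auto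
    obtain b where b: "b \<in> \<rat>" "l - \<epsilon> / 2 < b" "b < l - \<epsilon> / 3"
      using Rats_dense_in_real[of "l - \<epsilon> / 2" "l - \<epsilon> / 3"] \<epsilon>(1) by auto
    show False
    proof (rule no_crossing[OF a(1) b(1)])
      show "0 \<le> a"
        using low[of 0] nonneg a by (smt (verit))
      show "\<exists>k\<ge>n. m k < a" for n
        using low[of n] a by (smt (verit))
      show "\<exists>k\<ge>n. b < m k" for n
        using close[of n] b by (smt (verit))
    qed (use a b in auto)
  qed
qed

section \<open>Computable martingales\<close>

text \<open>A halting computation consults finitely many oracle values; the continuity of computable
  martingales comes from here.\<close>

lemma computes_use:
  "computes A p x y \<Longrightarrow> \<exists>L. \<forall>B. (\<forall>i<L. A i = B i) \<longrightarrow> computes B p x y"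
proof (induction rule: computes.induct)
  case (query x)
  have "computes B Query x (A x)" if "\<forall>i<Suc x. A i = B i" for B
    using computes.query[of B x] that by simp
  then show ?case by blast
next
  case (tuple p x y q z)
  then obtain L M where "\<forall>B. (\<forall>i<L. A i = B i) \<longrightarrow> computes B p x y"
    "\<forall>B. (\<forall>i<M. A i = B i) \<longrightarrow> computes B q x z"
    by blast
  then show ?case
    by (intro exI[of _ "max L M"]) (simp add: computes.tuple)
next
  case (compose q x y p z)
  then obtain L M where "\<forall>B. (\<forall>i<L. A i = B i) \<longrightarrow> computes B q x y"
    "\<forall>B. (\<forall>i<M. A i = B i) \<longrightarrow> computes B p y z"
    by blast
  then show ?case
    by (intro exI[of _ "max L M"]) (metis computes.compose less_max_iff_disj)
next
  case (primrec_0 p x y q)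
  then show ?case by (blast intro: computes.primrec_0)
next
  case (primrec_Suc p q x n y z)
  then obtain L M where "\<forall>B. (\<forall>i<L. A i = B i) \<longrightarrow> computes B (PrimRec p q) (prod_encode (x, n)) y"
    "\<forall>B. (\<forall>i<M. A i = B i) \<longrightarrow> computes B q (prod_encode (x, prod_encode (n, y))) z"
    by blast
  then show ?case
    by (intro exI[of _ "max L M"]) (metis computes.primrec_Suc less_max_iff_disj)
next
  case (mu p x n)
  then obtain L where L: "\<forall>B. (\<forall>i<L. A i = B i) \<longrightarrow> computes B p (prod_encode (x, n)) 0"
    by blast
  obtain v M where M: "\<And>m. m < n \<Longrightarrow>
      \<forall>B. (\<forall>i<M m. A i = B i) \<longrightarrow> computes B p (prod_encode (x, m)) (Suc (v m))"
    using mu.IH(2) by metis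
  define N where "N = L + (\<Sum>m<n. M m)"
  have "computes B (Mu p) x n" if B: "\<forall>i<N. A i = B i" for B
  proof (rule computes.mu)
    show "computes B p (prod_encode (x, n)) 0"
      using L B by (simp add: N_def)
    fix m assume m: "m < n"
    then have "M m \<le> (\<Sum>m<n. M m)"
      by (intro member_le_sum) auto
    then show "\<exists>v. computes B p (prod_encode (x, m)) (Suc v)"
      using M[OF m] B by (intro exI[of _ "v m"]) (simp add: N_def)
  qed
  then show ?case by blast
qed (blast intro: computes.intros)+

lemma names_real_unique:
  assumes "names_real A p n r" "names_real A p n r'"
  shows "r = r'"
proof -
  have *: "\<bar>r - r'\<bar> \<le> 2 * (1 / 2) ^ k" for k
  proof -
    obtain q where q: "computes A p (prod_encode (n, k)) q" "\<bar>real_of_rat (nat_to_rat_surj q) - r\<bar> \<le> (1 / 2) ^ k"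
      using assms(1) unfolding names_real_def by blast
    obtain q' where q': "computes A p (prod_encode (n, k)) q'" "\<bar>real_of_rat (nat_to_rat_surj q') - r'\<bar> \<le> (1 / 2) ^ k"
      using assms(2) unfolding names_real_def by blast
    have "q = q'"
      using q(1) q'(1) by (rule computes_deterministic)
    with q(2) q'(2) show ?thesis by simp
  qed
  have "(\<lambda>k. 2 * (1 / 2 :: real) ^ k) \<longlonglongrightarrow> 2 * 0"
    by (intro tendsto_intros LIMSEQ_power_zero) simp
  then have "\<bar>r - r'\<bar> \<le> 2 * 0"
    using * by (intro LIMSEQ_le_const[where X = "\<lambda>k. 2 * (1 / 2 :: real) ^ k"]) auto
  then show ?thesis by simp
qed

definition nonneg_computable_martingales :: "(nat \<Rightarrow> (nat \<Rightarrow> nat \<Rightarrow> bool) \<Rightarrow> real) set" where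
  "nonneg_computable_martingales = {M. computable_martingale M \<and> (\<forall>n \<omega>. 0 \<le> M n \<omega>)}"

lemma computable_martingale_names:
  assumes "computable_martingale M"
  obtains p where "\<And>n \<omega>. names_real (rows_oracle (initial_rows n \<omega>)) p n (M n \<omega>)"
  using assms unfolding computable_martingale_def by blast

text \<open>Names are demanded at every sequence and not only almost everywhere, so a program
  determines its martingale as a function.\<close>

lemma countable_martingales: "countable nonneg_computable_martingales"
proof -
  define prog where
    "prog M = (SOME p. \<forall>n \<omega>. names_real (rows_oracle (initial_rows n \<omega>)) p n (M n \<omega>))" for M
  have prog: "names_real (rows_oracle (initial_rows n \<omega>)) (prog M) n (M n \<omega>)"
    if "M \<in> nonneg_computable_martingales" for M n \<omega>
  proof -
    have "\<exists>p. \<forall>n \<omega>. names_real (rows_oracle (initial_rows n \<omega>)) p n (M n \<omega>)"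
      using that unfolding nonneg_computable_martingales_def computable_martingale_def by blast
    from someI_ex[OF this] show ?thesis unfolding prog_def by blast
  qed
  have "inj_on prog nonneg_computable_martingales"
  proof (intro inj_onI ext)
    fix M M' n \<omega>
    assume "M \<in> nonneg_computable_martingales" "M' \<in> nonneg_computable_martingales" "prog M = prog M'"
    then show "M n \<omega> = M' n \<omega>"
      using prog[of M n \<omega>] prog[of M' n \<omega>] names_real_unique by metis
  qed
  moreover have "countable (prog ` nonneg_computable_martingales)"
    using countable_recfun by (rule countable_subset[OF subset_UNIV])
  ultimately show ?thesis
    by (rule countable_image_inj_on[rotated])
qed

lemma computable_martingale_local:
  assumes "computable_martingale M" and "\<And>m. m < n \<Longrightarrow> \<omega> m = \<omega>' m"
  shows "M n \<omega> = M n \<omega>'"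
proof -
  have "initial_rows n \<omega> = initial_rows n \<omega>'"
    using assms(2) by (simp add: initial_rows_def)
  then show ?thesis
    using computable_martingale_names[OF assms(1)] names_real_unique by metis
qed

lemma computable_martingale_continuous:
  assumes "computable_martingale M" and "\<delta> > 0"
  shows "\<exists>L. \<forall>\<omega>'. (\<forall>m<L. \<forall>j<L. \<omega> m j = \<omega>' m j) \<longrightarrow> \<bar>M n \<omega>' - M n \<omega>\<bar> \<le> \<delta>"
proof -
  obtain p where p: "\<And>n \<omega>. names_real (rows_oracle (initial_rows n \<omega>)) p n (M n \<omega>)"
    using computable_martingale_names[OF assms(1)] by blast
  obtain k where k: "(1 / 2) ^ k < \<delta> / 2"
    using real_arch_pow_inv[of "\<delta> / 2" "1 / 2"] assms(2) by auto
  obtain q where q: "computes (rows_oracle (initial_rows n \<omega>)) p (prod_encode (n, k)) q"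
    "\<bar>real_of_rat (nat_to_rat_surj q) - M n \<omega>\<bar> \<le> (1 / 2) ^ k"
    using p[of n \<omega>] unfolding names_real_def by blast
  obtain L where L: "\<And>B. (\<forall>i<L. rows_oracle (initial_rows n \<omega>) i = B i) \<Longrightarrow> computes B p (prod_encode (n, k)) q"
    using computes_use[OF q(1)] by blast
  have "\<bar>M n \<omega>' - M n \<omega>\<bar> \<le> \<delta>" if \<omega>': "\<forall>m<L. \<forall>j<L. \<omega> m j = \<omega>' m j" for \<omega>'
  proof -
    have "rows_oracle (initial_rows n \<omega>) i = rows_oracle (initial_rows n \<omega>') i" if "i < L" for i
    proof -
      have "pi1 i < L" "pi2 i < L"
        using that le_prod_encode_1[of "pi1 i" "pi2 i"] le_prod_encode_2[of "pi2 i" "pi1 i"] by auto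
      then show ?thesis
        using \<omega>' by (simp add: rows_oracle_def initial_rows_def case_prod_beta')
    qed
    then have "computes (rows_oracle (initial_rows n \<omega>')) p (prod_encode (n, k)) q"
      by (intro L) auto
    moreover obtain q' where "computes (rows_oracle (initial_rows n \<omega>')) p (prod_encode (n, k)) q'"
      "\<bar>real_of_rat (nat_to_rat_surj q') - M n \<omega>'\<bar> \<le> (1 / 2) ^ k"
      using p[of n \<omega>'] unfolding names_real_def by blast
    ultimately have "\<bar>real_of_rat (nat_to_rat_surj q) - M n \<omega>'\<bar> \<le> (1 / 2) ^ k"
      using computes_deterministic by metis
    then show ?thesis
      using q(2) k by linarith
  qed
  then show ?thesis by blast
qed

text \<open>
  The martingale property only holds almost everywhere, so the construction of a single sequence
  has to keep track of the points where it holds.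
\<close>

definition fair_at :: "(nat \<Rightarrow> (nat \<Rightarrow> nat \<Rightarrow> bool) \<Rightarrow> real) \<Rightarrow> nat \<Rightarrow> (nat \<Rightarrow> nat \<Rightarrow> bool) \<Rightarrow> bool" where
  "fair_at M n \<omega> \<longleftrightarrow> integrable rows (\<lambda>\<xi>. M (Suc n) (comb_seq n \<omega> \<xi>)) \<and>
     cond_expect n (M (Suc n)) \<omega> = M n \<omega>"

lemma AE_fair_at:
  assumes "martingale M"
  shows "AE \<omega> in rows. fair_at M n \<omega>"
proof -
  interpret P: pair_prob_space rows rows ..
  have "integrable rows (M (Suc n))"
    using assms by (simp add: martingale_def)
  then have M: "integrable (distr (rows \<Otimes>\<^sub>M rows) rows (\<lambda>(\<omega>, \<xi>). comb_seq n \<omega> \<xi>)) (M (Suc n))"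
    by (simp add: row_space.PiM_comb_seq)
  have "(\<lambda>(\<omega>, \<xi>). comb_seq n \<omega> \<xi>) \<in> measurable (rows \<Otimes>\<^sub>M rows) rows"
    using measurable_comb_seq[of n cantor] by (simp add: rows_def)
  from integrable_distr[OF this M]
  have "integrable (rows \<Otimes>\<^sub>M rows) (\<lambda>(\<omega>, \<xi>). M (Suc n) (comb_seq n \<omega> \<xi>))"
    by (simp add: case_prod_beta')
  from P.AE_integrable_fst'[OF this]
  have "AE \<omega> in rows. integrable rows (\<lambda>\<xi>. M (Suc n) (comb_seq n \<omega> \<xi>))"
    by simp
  moreover have "AE \<omega> in rows. cond_expect n (M (Suc n)) \<omega> = M n \<omega>"
    using assms unfolding martingale_def by (metis le_SucI order_refl)
  ultimately show ?thesis
    unfolding fair_at_def by eventually_elim blast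
qed

lemma fair_at_cong:
  assumes "computable_martingale M" and "\<And>m. m < n \<Longrightarrow> \<omega> m = \<omega>' m"
  shows "fair_at M n \<omega> \<longleftrightarrow> fair_at M n \<omega>'"
proof -
  have "comb_seq n \<omega> = comb_seq n \<omega>'"
    using assms(2) by (auto simp: comb_seq_def fun_eq_iff)
  moreover have "M n \<omega> = M n \<omega>'"
    using assms by (rule computable_martingale_local)
  ultimately show ?thesis
    by (simp add: fair_at_def cond_expect_def)
qed


section \<open>A Doob random that is not Schnorr random\<close>

definition dense_rows :: "nat \<Rightarrow> (nat \<Rightarrow> bool) set" where
  "dense_rows n = {x. \<exists>s. \<forall>t<Suc (n + s). x (prod_encode (s, t))}"

lemma join_rows_in_ones_test: "join_rows \<omega> \<in> ones_test n \<longleftrightarrow> \<omega> n \<in> dense_rows n"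
  by (simp add: ones_test_def ones_block_def dense_rows_def)

text \<open>Block \<open>L\<close> occupies positions not below \<open>L\<close> and can be filled
  with ones above any prescribed prefix. The resulting condition is finite, so it has positive
  measure and meets every almost sure event.\<close>

lemma dense_rows_dense: "\<exists>F a. finite F \<and> agree F a \<subseteq> dense_rows n \<inter> agree {..<L} x"
proof -
  define F where "F = {..<L} \<union> (\<lambda>t. prod_encode (L, t)) ` {..<Suc (n + L)}"
  define a where "a p = (if p < L then x p else True)" for p
  have "\<not> prod_encode (L, t) < L" for t
    using le_prod_encode_1[of L t] by simp
  then have "agree F a \<subseteq> dense_rows n \<inter> agree {..<L} x"
    unfolding agree_def F_def a_def dense_rows_def by (auto intro!: exI[of _ L])
  moreover have "finite F"
    by (simp add: F_def)
  ultimately show ?thesis by blast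
qed

lemma AE_cantor_agree:
  assumes "AE x in cantor. P x" "finite F"
  shows "\<exists>x\<in>agree F a. P x"
proof (rule ccontr)
  assume "\<not> ?thesis"
  with assms(1) have "AE x in cantor. x \<notin> agree F a"
    by (auto elim!: eventually_mono)
  then have "measure cantor (agree F a) = 0"
    by (subst (asm) AE_iff_measurable[OF agree_measurable]) (auto simp: measure_def)
  then show False
    using assms(2) by (simp add: measure_agree)
qed

text \<open>Holding for almost all continuations is the form of the invariant that survives fixing
  one more row: the first row of the continuation is split off, and Fubini applies.\<close>

lemma AE_rows_step:
  assumes "AE \<xi> in rows. P (comb_seq n \<omega> \<xi>)"
  shows "AE y in cantor. AE \<xi> in rows. P (comb_seq (Suc n) (\<omega> (n := y)) \<xi>)"
proof -
  interpret R: pair_prob_space cantor rows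
    by unfold_locales
  have meas: "(\<lambda>(y, \<xi>). case_nat y \<xi>) \<in> measurable (cantor \<Otimes>\<^sub>M rows) rows"
    unfolding rows_def by measurable
  have "AE \<xi> in distr (cantor \<Otimes>\<^sub>M rows) rows (\<lambda>(y, \<xi>). case_nat y \<xi>). P (comb_seq n \<omega> \<xi>)"
    unfolding row_space.PiM_iter by (rule assms)
  from AE_distrD[OF meas this]
  have "AE z in cantor \<Otimes>\<^sub>M rows. P (comb_seq n \<omega> (case z of (y, \<xi>) \<Rightarrow> case_nat y \<xi>))" .
  from R.AE_pair[OF this]
  have "AE y in cantor. AE \<xi> in rows. P (comb_seq n \<omega> (case_nat y \<xi>))"
    by simp
  moreover have "comb_seq n \<omega> (case_nat y \<xi>) = comb_seq (Suc n) (\<omega> (n := y)) \<xi>" for y \<xi>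
  proof -
    have "comb_seq n \<omega> = comb_seq n (\<omega> (n := y))"
      by (auto simp: comb_seq_def fun_eq_iff)
    then show ?thesis
      by (simp add: comb_seq_Suc)
  qed
  ultimately show ?thesis by simp
qed

lemma ex_le_expectation:
  assumes "integrable rows (f :: _ \<Rightarrow> real)"
  shows "\<exists>\<xi>. f \<xi> \<le> (\<integral>\<xi>. f \<xi> \<partial>rows)"
proof (rule ccontr)
  assume "\<not> ?thesis"
  then have gt: "(\<integral>\<xi>. f \<xi> \<partial>rows) < f \<xi>" for \<xi>
    by (simp add: not_le)
  have "(\<integral>\<xi>. f \<xi> - (\<integral>\<xi>. f \<xi> \<partial>rows) \<partial>rows) = 0"
    using assms by simp
  then have "AE \<xi> in rows. f \<xi> - (\<integral>\<xi>. f \<xi> \<partial>rows) = 0"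
    using assms gt by (subst (asm) integral_nonneg_eq_0_iff_AE) (auto intro: less_imp_le)
  then have "AE \<xi> in rows. False"
  proof eventually_elim
    case (elim \<xi>)
    then show ?case using gt[of \<xi>] by simp
  qed
  then show False
    using row_space.P.AE_False by simp
qed

text \<open>
  The rows are chosen one after the other in the open dense sets \<open>dense_rows n\<close>.  For every
  martingale \<open>M j\<close>, the wealth of the upcrossing strategy with bounds \<open>a j\<close>, \<open>b j\<close> enters a weighted
  sum at stage \<open>j\<close>.  As the past is fixed, this sum is a continuous function of the next row
  with the present value as its average, so it can be kept bounded.
\<close>

locale upcrossing_control =
  fixes M :: "nat \<Rightarrow> nat \<Rightarrow> (nat \<Rightarrow> nat \<Rightarrow> bool) \<Rightarrow> real" and a b :: "nat \<Rightarrow> real"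
  assumes M: "M j \<in> nonneg_computable_martingales"
    and a: "0 \<le> a j" and ab: "a j < b j"
begin

lemma computable_M: "computable_martingale (M j)" and M_nonneg: "0 \<le> M j n \<omega>"
  using M[of j] by (simp_all add: nonneg_computable_martingales_def)

definition \<Phi> :: "nat \<Rightarrow> nat \<Rightarrow> (nat \<Rightarrow> nat \<Rightarrow> bool) \<Rightarrow> real" where
  "\<Phi> j n \<omega> = wealth (a j) (b j) (\<lambda>k. M j k \<omega>) n"

text \<open>Strategy \<open>j\<close> may already be wealthy when it enters at stage
  \<open>j\<close>; the denominator keeps its first contribution below \<open>2^-j\<close> and
  depends only on the first \<open>j\<close> rows.\<close>

definition weight :: "nat \<Rightarrow> (nat \<Rightarrow> nat \<Rightarrow> bool) \<Rightarrow> real" where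
  "weight j \<omega> = (1 / 2) ^ j / (1 + \<Phi> j j \<omega>)"

definition total :: "nat \<Rightarrow> nat \<Rightarrow> (nat \<Rightarrow> nat \<Rightarrow> bool) \<Rightarrow> real" where
  "total k n \<omega> = (\<Sum>j<k. weight j \<omega> * \<Phi> j n \<omega>)"

definition fair :: "(nat \<Rightarrow> nat \<Rightarrow> bool) \<Rightarrow> bool" where
  "fair \<omega> \<longleftrightarrow> (\<forall>j n. fair_at (M j) n \<omega>)"

definition step_ok :: "nat \<Rightarrow> (nat \<Rightarrow> nat \<Rightarrow> bool) \<Rightarrow> (nat \<Rightarrow> nat \<Rightarrow> bool) \<Rightarrow> bool" where
  "step_ok n \<omega> \<omega>' \<longleftrightarrow> (\<forall>m<n. \<omega>' m = \<omega> m) \<and> \<omega>' n \<in> dense_rows n \<and>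
     total (Suc n) (Suc n) \<omega>' \<le> total (Suc n) n \<omega> + (1 / 2) ^ n"

lemma \<Phi>_nonneg: "0 \<le> \<Phi> j n \<omega>"
  using wealth_ge[OF ab[of j], where m = "\<lambda>k. M j k \<omega>" and n = n] M_nonneg[of j n \<omega>] a[of j] ab[of j]
  unfolding \<Phi>_def by (smt (verit) mult_nonneg_nonneg of_nat_0_le_iff)

lemma weight_pos: "0 < weight j \<omega>"
  unfolding weight_def using \<Phi>_nonneg[of j j \<omega>] by (intro divide_pos_pos) auto

lemma M_cong: "(\<And>m. m < n \<Longrightarrow> \<omega> m = \<omega>' m) \<Longrightarrow> k \<le> n \<Longrightarrow> M j k \<omega> = M j k \<omega>'"
  by (rule computable_martingale_local[OF computable_M]) auto

lemma \<Phi>_cong: "(\<And>m. m < n \<Longrightarrow> \<omega> m = \<omega>' m) \<Longrightarrow> \<Phi> j n \<omega> = \<Phi> j n \<omega>'"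
  unfolding \<Phi>_def by (rule wealth_cong) (rule M_cong)

lemma weight_cong: "(\<And>m. m < n \<Longrightarrow> \<omega> m = \<omega>' m) \<Longrightarrow> j \<le> n \<Longrightarrow> weight j \<omega> = weight j \<omega>'"
  unfolding weight_def by (subst \<Phi>_cong[of j \<omega> \<omega>' j]) auto

lemma total_cong: "(\<And>m. m < n \<Longrightarrow> \<omega> m = \<omega>' m) \<Longrightarrow> k \<le> Suc n \<Longrightarrow> total k n \<omega> = total k n \<omega>'"
  unfolding total_def
  by (intro sum.cong refl arg_cong2[where f = "(*)"] weight_cong[of n] \<Phi>_cong) auto

lemma AE_fair: "AE \<omega> in rows. fair \<omega>"
  unfolding fair_def AE_all_countable
  using AE_fair_at computable_M unfolding computable_martingale_def by blast

lemma step_exists: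
  assumes fair: "AE \<xi> in rows. fair (comb_seq n \<omega> \<xi>)"
  shows "\<exists>\<omega>'. (AE \<xi> in rows. fair (comb_seq (Suc n) \<omega>' \<xi>)) \<and> step_ok n \<omega> \<omega>'"
proof -
  define d where "d j = weight j \<omega> * (if holding (a j) (b j) (\<lambda>k. M j k \<omega>) n then 2 else 1)" for j
  define T where "T y = total (Suc n) n \<omega> + (\<Sum>j<Suc n. d j * (M j (Suc n) (\<omega> (n := y)) - M j n \<omega>))" for y
  have d: "0 < d j" for j
    unfolding d_def using weight_pos[of j \<omega>] by auto
  have total: "total (Suc n) (Suc n) (\<omega> (n := y)) = T y" for y
  proof -
    have "weight j (\<omega> (n := y)) * \<Phi> j (Suc n) (\<omega> (n := y)) =
        weight j \<omega> * \<Phi> j n \<omega> + d j * (M j (Suc n) (\<omega> (n := y)) - M j n \<omega>)" if "j < Suc n" for j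
    proof -
      have "weight j (\<omega> (n := y)) = weight j \<omega>"
        using that by (intro weight_cong[of n]) auto
      moreover have "\<Phi> j n (\<omega> (n := y)) = \<Phi> j n \<omega>"
        by (intro \<Phi>_cong) auto
      moreover have "M j n (\<omega> (n := y)) = M j n \<omega>"
        by (intro M_cong[of n]) auto
      moreover have "holding (a j) (b j) (\<lambda>k. M j k (\<omega> (n := y))) n = holding (a j) (b j) (\<lambda>k. M j k \<omega>) n"
        by (intro holding_cong M_cong[of n]) auto
      ultimately show ?thesis
        unfolding d_def by (simp add: \<Phi>_def algebra_simps)
    qed
    then show ?thesis
      unfolding total_def T_def by (simp add: sum.distrib[symmetric] del: sum.lessThan_Suc)
  qed
  obtain \<xi>0 where "fair (comb_seq n \<omega> \<xi>0)"
    using eventually_happens'[OF row_space.P.ae_filter_bot fair] by blast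
  then have fair_at: "fair_at (M j) n \<omega>" for j
    using fair_at_cong[OF computable_M, of n \<omega> "comb_seq n \<omega> \<xi>0"] by (simp add: fair_def comb_seq_less)
  have M_comb: "M j (Suc n) (comb_seq n \<omega> \<xi>) = M j (Suc n) (\<omega> (n := \<xi> 0))" for j \<xi>
    by (rule M_cong[of "Suc n"]) (auto simp: comb_seq_def less_Suc_eq)
  have int: "integrable rows (\<lambda>\<xi>. M j (Suc n) (\<omega> (n := \<xi> 0)))" for j
    using fair_at[of j] by (simp add: fair_at_def M_comb)
  have expect: "(\<integral>\<xi>. M j (Suc n) (\<omega> (n := \<xi> 0)) \<partial>rows) = M j n \<omega>" for j
    using fair_at[of j] by (simp add: fair_at_def cond_expect_def M_comb)
  have "integrable rows (\<lambda>\<xi>. T (\<xi> 0))"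
    unfolding T_def using int
    by (intro Bochner_Integration.integrable_add Bochner_Integration.integrable_sum
        integrable_mult_right Bochner_Integration.integrable_diff) auto
  moreover have "(\<integral>\<xi>. T (\<xi> 0) \<partial>rows) = total (Suc n) n \<omega>"
    unfolding T_def using int
    by (subst Bochner_Integration.integral_add)
      (auto simp: expect Bochner_Integration.integral_sum simp del: sum.lessThan_Suc)
  \<comment> \<open>This row controls the sum but may be neither in the dense set nor fair;
    continuity permits moving to a nearby row that is both.\<close>
  ultimately obtain y0 where y0: "T y0 \<le> total (Suc n) n \<omega>"
    using ex_le_expectation[of "\<lambda>\<xi>. T (\<xi> 0)"] by auto
  \<comment> \<open>An increase of every martingale by \<open>\<delta>\<close> raises the weighted
    sum by at most \<open>(1 / 2) ^ n\<close>.\<close>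
  define \<delta> where "\<delta> = (1 / 2) ^ n / (1 + (\<Sum>j<Suc n. d j))"
  have sum_d: "0 \<le> (\<Sum>j<Suc n. d j)"
    using d by (intro sum_nonneg) (auto intro: less_imp_le)
  then have \<delta>: "\<delta> > 0"
    unfolding \<delta>_def by (intro divide_pos_pos) auto
  have "\<forall>j. \<exists>L. \<forall>\<omega>'. (\<forall>m<L. \<forall>i<L. (\<omega> (n := y0)) m i = \<omega>' m i) \<longrightarrow>
      \<bar>M j (Suc n) \<omega>' - M j (Suc n) (\<omega> (n := y0))\<bar> \<le> \<delta>"
    using computable_martingale_continuous[OF computable_M \<delta>] by blast
  from choice[OF this] obtain L where L: "\<And>j \<omega>'. (\<forall>m<L j. \<forall>i<L j. (\<omega> (n := y0)) m i = \<omega>' m i) \<Longrightarrow>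
      \<bar>M j (Suc n) \<omega>' - M j (Suc n) (\<omega> (n := y0))\<bar> \<le> \<delta>"
    by blast
  define L' where "L' = (\<Sum>j<Suc n. L j)"
  obtain F c where F: "finite F" "agree F c \<subseteq> dense_rows n \<inter> agree {..<L'} y0"
    using dense_rows_dense by blast
  obtain y where y: "y \<in> agree F c" "AE \<xi> in rows. fair (comb_seq (Suc n) (\<omega> (n := y)) \<xi>)"
    using AE_cantor_agree[OF AE_rows_step[OF fair] F(1)] by blast
  have close: "M j (Suc n) (\<omega> (n := y)) - M j (Suc n) (\<omega> (n := y0)) \<le> \<delta>" if "j < Suc n" for j
  proof -
    have "L j \<le> L'"
      unfolding L'_def using that by (intro member_le_sum) auto
    then have "(\<omega> (n := y0)) m i = (\<omega> (n := y)) m i" if "i < L j" for m i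
      using y(1) F(2) that by (auto simp: agree_def subset_eq)
    then show ?thesis
      using L[of j "\<omega> (n := y)"] by auto
  qed
  have "T y - T y0 = (\<Sum>j<Suc n. d j * (M j (Suc n) (\<omega> (n := y)) - M j (Suc n) (\<omega> (n := y0))))"
    unfolding T_def by (simp add: sum_subtractf[symmetric] algebra_simps del: sum.lessThan_Suc)
  also have "\<dots> \<le> (\<Sum>j<Suc n. d j * \<delta>)"
    using close d by (intro sum_mono mult_left_mono) (auto intro: less_imp_le)
  also have "\<dots> = (\<Sum>j<Suc n. d j) * \<delta>"
    by (rule sum_distrib_right[symmetric])
  also have "\<dots> = (1 / 2) ^ n * ((\<Sum>j<Suc n. d j) / (1 + (\<Sum>j<Suc n. d j)))"
    by (simp add: \<delta>_def del: sum.lessThan_Suc)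
  also have "\<dots> \<le> (1 / 2) ^ n * 1"
    using sum_d by (intro mult_left_mono) (auto simp del: sum.lessThan_Suc)
  finally have "total (Suc n) (Suc n) (\<omega> (n := y)) \<le> total (Suc n) n \<omega> + (1 / 2) ^ n"
    using y0 unfolding total by simp
  then have "step_ok n \<omega> (\<omega> (n := y))"
    unfolding step_ok_def using y(1) F(2) by auto
  with y(2) show ?thesis by blast
qed

lemma controlled_rows:
  obtains \<omega> where "\<And>n. \<omega> n \<in> dense_rows n" and "\<And>j. \<exists>C. \<forall>n. wealth (a j) (b j) (\<lambda>k. M j k \<omega>) n \<le> C"
proof -
  have "AE \<xi> in rows. fair (comb_seq 0 (\<lambda>_ _. False) \<xi>)"
    using AE_fair by (simp add: comb_seq_0)
  then obtain f where f: "\<And>n. step_ok n (f n) (f (Suc n))"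
    using dependent_nat_choice[of "\<lambda>n \<omega>. AE \<xi> in rows. fair (comb_seq n \<omega> \<xi>)" step_ok] step_exists by metis
  have stable: "f k m = f n m" if "n \<le> k" "m < n" for k m n
    using that
  proof (induction rule: dec_induct)
    case (step k)
    then show ?case using f[of k] unfolding step_ok_def by simp
  qed simp
  define \<omega> where "\<omega> m = f (Suc m) m" for m
  have \<omega>: "\<omega> m = f n m" if "m < n" for m n
    unfolding \<omega>_def using that stable[of "Suc m" n m] by simp
  have "\<omega> n \<in> dense_rows n" for n
    using f[of n] unfolding \<omega>_def step_ok_def by blast
  moreover have "\<exists>C. \<forall>n. wealth (a j) (b j) (\<lambda>k. M j k \<omega>) n \<le> C" for j
  proof -
    have step: "total (Suc n) (Suc n) \<omega> \<le> total (Suc n) n \<omega> + (1 / 2) ^ n" for n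
    proof -
      have "total (Suc n) (Suc n) \<omega> = total (Suc n) (Suc n) (f (Suc n))"
        using \<omega> by (intro total_cong) auto
      moreover have "total (Suc n) n \<omega> = total (Suc n) n (f n)"
        using \<omega> by (intro total_cong) auto
      ultimately show ?thesis
        using f[of n] by (simp add: step_ok_def)
    qed
    have new: "weight n \<omega> * \<Phi> n n \<omega> \<le> (1 / 2) ^ n" for n
    proof -
      have "\<Phi> n n \<omega> / (1 + \<Phi> n n \<omega>) \<le> 1"
        using \<Phi>_nonneg[of n n \<omega>] by simp
      then have "(1 / 2) ^ n * (\<Phi> n n \<omega> / (1 + \<Phi> n n \<omega>)) \<le> (1 / 2) ^ n * 1"
        by (intro mult_left_mono) auto
      then show ?thesis by (simp add: weight_def)
    qed
    \<comment> \<open>Stage \<open>n\<close> adds at most twice \<open>(1 / 2) ^ n\<close>: once for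
      the strategy that enters and once for the error of the step.\<close>
    have bound: "total n n \<omega> \<le> 4 - 4 * (1 / 2) ^ n" for n
    proof (induction n)
      case (Suc n)
      have "total (Suc n) n \<omega> = total n n \<omega> + weight n \<omega> * \<Phi> n n \<omega>"
        by (simp add: total_def)
      then show ?case
        using Suc step[of n] new[of n] by simp
    qed (simp add: total_def)
    have "\<Phi> j n \<omega> \<le> 4 / weight j \<omega>" if "j < n" for n
    proof -
      have "weight j \<omega> * \<Phi> j n \<omega> \<le> total n n \<omega>"
        unfolding total_def using that weight_pos \<Phi>_nonneg
        by (intro member_le_sum[of j "{..<n}" "\<lambda>j. weight j \<omega> * \<Phi> j n \<omega>"]) (auto intro!: mult_nonneg_nonneg intro: less_imp_le)
      also have "\<dots> \<le> 4"
        using bound[of n] by (smt (verit) zero_less_power half_gt_zero_iff)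
      finally show ?thesis
        using weight_pos[of j \<omega>] by (simp add: field_simps)
    qed
    \<comment> \<open>The total controls strategy \<open>j\<close> only after stage
      \<open>j\<close>; the finitely many earlier values are bounded by their sum.\<close>
    moreover have "\<Phi> j n \<omega> \<le> (\<Sum>k\<le>j. \<Phi> j k \<omega>)" if "n \<le> j" for n
      using that \<Phi>_nonneg by (intro member_le_sum) auto
    ultimately have "\<Phi> j n \<omega> \<le> max (4 / weight j \<omega>) (\<Sum>k\<le>j. \<Phi> j k \<omega>)" for n
      by (metis le_max_iff_disj not_le)
    then show ?thesis
      unfolding \<Phi>_def by blast
  qed
  ultimately show thesis
    using that by blast
qed

end

lemma Doob_not_Schnorr: "\<exists>\<omega>. Doob_random \<omega> \<and> \<not> Schnorr_random \<omega>"
proof -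
  define I where "I = nonneg_computable_martingales \<times> {(a, b). a \<in> \<rat> \<and> b \<in> \<rat> \<and> 0 \<le> a \<and> a < (b :: real)}"
  have "countable ((\<rat> :: real set) \<times> (\<rat> :: real set))"
    by (intro countable_SIGMA countable_rat)
  then have I: "countable I"
    unfolding I_def by (intro countable_SIGMA countable_martingales) (auto elim: countable_subset[rotated])
  have "(capital, 0, 1) \<in> I"
    unfolding I_def nonneg_computable_martingales_def
    using computable_martingale_capital capital_nonneg by simp
  then have "I \<noteq> {}" by blast
  define J where "J = from_nat_into I"
  have J: "J j \<in> I" for j
    unfolding J_def using \<open>I \<noteq> {}\<close> by (rule from_nat_into)
  interpret upcrossing_control "\<lambda>j. fst (J j)" "\<lambda>j. fst (snd (J j))" "\<lambda>j. snd (snd (J j))"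
    by unfold_locales (use J in \<open>auto simp: I_def mem_Times_iff case_prod_beta'\<close>)
  obtain \<omega> where dense: "\<And>n. \<omega> n \<in> dense_rows n" and
    bounded: "\<And>j. \<exists>C. \<forall>n. wealth (fst (snd (J j))) (snd (snd (J j))) (\<lambda>k. fst (J j) k \<omega>) n \<le> C"
    using controlled_rows by blast
  have "Doob_random \<omega>"
    unfolding Doob_random_def
  proof (intro allI impI)
    fix M assume M: "computable_martingale M \<and> (\<forall>n \<omega>'. 0 \<le> M n \<omega>')"
    show "convergent (\<lambda>n. M n \<omega>)"
    proof (rule convergent_if_wealth_bounded)
      fix a b :: real assume "a \<in> \<rat>" "b \<in> \<rat>" "0 \<le> a" "a < b"
      with M have "(M, a, b) \<in> I"
        by (simp add: I_def nonneg_computable_martingales_def)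
      then obtain j where "J j = (M, a, b)"
        unfolding J_def using from_nat_into_surj[OF I] by blast
      with bounded[of j] show "\<exists>C. \<forall>n. wealth a b (\<lambda>n. M n \<omega>) n \<le> C"
        by simp
    qed (use M in blast)
  qed
  moreover have "\<not> Schnorr_random \<omega>"
    unfolding Schnorr_random_def using Schnorr_test_ones_test dense join_rows_in_ones_test by blast
  ultimately show ?thesis by blast
qed

theorem theorem5p15:
  shows "(\<exists>\<omega>. Doob_random \<omega> \<and> \<not> Schnorr_random \<omega>) \<and>
         (\<exists>\<omega>. Schnorr_random \<omega> \<and> \<not> Doob_random \<omega>)"
  using Doob_not_Schnorr Schnorr_not_Doob ..


end
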